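(* Let $G$ be an $n$-dimensional Lie group ($n\geq 2$) equipped with a bi-invariant Riemannian metric, and let $S$ be a regular translation surface in $G$ whose Gaussian curvature (of the induced metric) is constant. Then $S$ is flat, i.e. its Gaussian curvature is identically zero.
   Context: A surface $M$ in an $n$-dimensional Lie group $G$ is called a translation surface if it can be locally written as the product of two curves, i.e. locally parametrized as $f(s,t)=a(s)\cdot b(t)$, where $a(s)$ and $b(t)$ are smooth curves in $G$ and $\cdot$ is the group multiplication of $G$. Regular means that the local parametrizations $f(s,t)=a(s)\cdot b(t)$ are immersions (the partial derivatives $f_s,f_t$ are linearly independent everywhere). The Gaussian curvature is the intrinsic curvature of the Riemannian metric induced on the surface from the bi-invariant metric of $G$. *)

theory Defs
  imports "HOL-Analysis.Analysis" "HOL-Algebra.Group"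
begin

section \<open>Smooth maps between open subsets of normed spaces\<close>

text \<open>\<open>C_k_on k f S\<close> and \<open>smooth_on f S\<close> are meant for open \<open>S\<close>: the derivatives are
  unrestricted Frechet derivatives.\<close>

primrec C_k_on :: "nat \<Rightarrow> ('a::real_normed_vector \<Rightarrow> 'b::real_normed_vector) \<Rightarrow> 'a set \<Rightarrow> bool" where
  "C_k_on 0 f S \<longleftrightarrow> continuous_on S f"
| "C_k_on (Suc k) f S \<longleftrightarrow>
     (\<forall>x\<in>S. f differentiable (at x)) \<and> (\<forall>v. C_k_on k (\<lambda>x. frechet_derivative f (at x) v) S)"

definition smooth_on :: "('a::real_normed_vector \<Rightarrow> 'b::real_normed_vector) \<Rightarrow> 'a set \<Rightarrow> bool" where
  "smooth_on f S \<longleftrightarrow> (\<forall>k. C_k_on k f S)"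

section \<open>Smooth manifolds\<close>

text \<open>A chart is a pair of its domain and its coordinate map; the values of the coordinate map
  outside the domain are irrelevant.\<close>

type_synonym ('a, 'e) chart = "'a set \<times> ('a \<Rightarrow> 'e)"

definition is_chart :: "'a topology \<Rightarrow> ('a, 'e::euclidean_space) chart \<Rightarrow> bool" where
  "is_chart X c \<longleftrightarrow> openin X (fst c) \<and> open (snd c ` fst c) \<and>
     homeomorphic_map (subtopology X (fst c)) (top_of_set (snd c ` fst c)) (snd c)"

definition in_charts :: "('a, 'd) chart \<Rightarrow> ('b, 'e) chart \<Rightarrow> ('a \<Rightarrow> 'b) \<Rightarrow> 'd \<Rightarrow> 'e" where
  "in_charts c d F = snd d \<circ> F \<circ> inv_into (fst c) (snd c)"

definition compatible ::
    "('a, 'd::euclidean_space) chart \<Rightarrow> ('a, 'd) chart \<Rightarrow> bool" where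
  "compatible c d \<longleftrightarrow>
     smooth_on (in_charts c d (\<lambda>p. p)) (snd c ` (fst c \<inter> fst d)) \<and>
     smooth_on (in_charts d c (\<lambda>p. p)) (snd d ` (fst c \<inter> fst d))"

text \<open>\<open>A\<close> is the maximal atlas.\<close>

definition smooth_manifold :: "'a topology \<Rightarrow> ('a, 'e::euclidean_space) chart set \<Rightarrow> bool" where
  "smooth_manifold X A \<longleftrightarrow>
     Hausdorff_space X \<and> second_countable X \<and>
     (\<forall>c\<in>A. is_chart X c) \<and>
     (\<Union>c\<in>A. fst c) = topspace X \<and>
     (\<forall>c\<in>A. \<forall>d\<in>A. compatible c d) \<and>
     (\<forall>c. is_chart X c \<and> (\<forall>d\<in>A. compatible c d) \<longrightarrow> c \<in> A)"

text \<open>The atlases here need not be maximal.\<close>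

definition smooth_map ::
    "'a topology \<Rightarrow> ('a, 'd::euclidean_space) chart set \<Rightarrow>
     'b topology \<Rightarrow> ('b, 'e::euclidean_space) chart set \<Rightarrow> ('a \<Rightarrow> 'b) \<Rightarrow> bool" where
  "smooth_map X A Y B F \<longleftrightarrow> continuous_map X Y F \<and>
     (\<forall>c\<in>A. \<forall>d\<in>B. smooth_on (in_charts c d F) (snd c ` (fst c \<inter> F -` fst d)))"

definition prod_atlas ::
    "('a, 'd) chart set \<Rightarrow> ('b, 'e) chart set \<Rightarrow> ('a \<times> 'b, 'd \<times> 'e) chart set" where
  "prod_atlas A B = {(fst c \<times> fst d, map_prod (snd c) (snd d)) | c d. c \<in> A \<and> d \<in> B}"

definition smooth_curve ::
    "real set \<Rightarrow> 'a topology \<Rightarrow> ('a, 'e::euclidean_space) chart set \<Rightarrow> (real \<Rightarrow> 'a) \<Rightarrow> bool" where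
  "smooth_curve I X A a \<longleftrightarrow> open I \<and> is_interval I \<and> smooth_map (top_of_set I) {(I, \<lambda>t. t)} X A a"

text \<open>The differential of \<open>F\<close> at \<open>p\<close>, with tangent vectors at \<open>p\<close> and at \<open>F p\<close> given by
  their components in the charts \<open>c\<close> and \<open>d\<close>.\<close>

definition differential ::
    "('a, 'd::euclidean_space) chart \<Rightarrow> ('b, 'e::euclidean_space) chart \<Rightarrow>
     ('a \<Rightarrow> 'b) \<Rightarrow> 'a \<Rightarrow> 'd \<Rightarrow> 'e" where
  "differential c d F p = frechet_derivative (in_charts c d F) (at (snd c p))"

definition immersion ::
    "'a topology \<Rightarrow> ('a, 'd::euclidean_space) chart set \<Rightarrow>
     'b topology \<Rightarrow> ('b, 'e::euclidean_space) chart set \<Rightarrow> ('a \<Rightarrow> 'b) \<Rightarrow> bool" where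
  "immersion X A Y B F \<longleftrightarrow> smooth_map X A Y B F \<and>
     (\<forall>c\<in>A. \<forall>d\<in>B. \<forall>p\<in>fst c. F p \<in> fst d \<longrightarrow> inj (differential c d F p))"

section \<open>Riemannian metrics\<close>

text \<open>A metric is given by its expressions in the charts: \<open>g c p v w\<close> is the inner product of the
  two tangent vectors at \<open>p\<close> whose components in the chart \<open>c\<close> are \<open>v\<close> and \<open>w\<close>.\<close>

type_synonym ('a, 'e) metric_field = "('a, 'e) chart \<Rightarrow> 'a \<Rightarrow> 'e \<Rightarrow> 'e \<Rightarrow> real"

definition isometric ::
    "('a, 'd::euclidean_space) chart set \<Rightarrow> ('a, 'd) metric_field \<Rightarrow>
     ('b, 'e::euclidean_space) chart set \<Rightarrow> ('b, 'e) metric_field \<Rightarrow> ('a \<Rightarrow> 'b) \<Rightarrow> bool" where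
  "isometric A g B h F \<longleftrightarrow>
     (\<forall>c\<in>A. \<forall>d\<in>B. \<forall>p\<in>fst c. F p \<in> fst d \<longrightarrow>
        (\<forall>v w. h d (F p) (differential c d F p v) (differential c d F p w) = g c p v w))"

text \<open>Isometry of the identity is the transformation law under changes of charts.\<close>

definition riemannian_metric ::
    "('a, 'e::euclidean_space) chart set \<Rightarrow> ('a, 'e) metric_field \<Rightarrow> bool" where
  "riemannian_metric A g \<longleftrightarrow>
     (\<forall>c\<in>A. \<forall>p\<in>fst c. bilinear (g c p) \<and> (\<forall>v w. g c p v w = g c p w v) \<and>
        (\<forall>v. v \<noteq> 0 \<longrightarrow> g c p v v > 0)) \<and>
     (\<forall>c\<in>A. \<forall>v w. smooth_on (\<lambda>x. g c (inv_into (fst c) (snd c) x) v w) (snd c ` fst c)) \<and>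
     isometric A g A g (\<lambda>p. p)"

text \<open>The pullback of \<open>g\<close> along \<open>F\<close>, where \<open>B\<close> is an atlas of the codomain. When \<open>g\<close> is a
  Riemannian metric, the choice of \<open>d\<close> is immaterial by the transformation law.\<close>

definition induced_metric ::
    "('b, 'e::euclidean_space) chart set \<Rightarrow> ('b, 'e) metric_field \<Rightarrow> ('a \<Rightarrow> 'b) \<Rightarrow>
     ('a, 'd::euclidean_space) metric_field" where
  "induced_metric B g F c p v w =
     (let d = (SOME d. d \<in> B \<and> F p \<in> fst d)
      in g d (F p) (differential c d F p v) (differential c d F p w))"

section \<open>Gaussian curvature\<close>

definition partial :: "'n \<Rightarrow> (real ^ 'n \<Rightarrow> real) \<Rightarrow> real ^ 'n::finite \<Rightarrow> real" where
  "partial i f x = frechet_derivative f (at x) (axis i 1)"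

definition metric_matrix ::
    "('a, real ^ 'n) metric_field \<Rightarrow> ('a, real ^ 'n) chart \<Rightarrow> real ^ 'n \<Rightarrow> real ^ 'n ^ 'n::finite" where
  "metric_matrix g c x =
     (\<chi> i j. g c (inv_into (fst c) (snd c) x) (axis i 1) (axis j 1))"

text \<open>\<open>christoffel g c k i j\<close> is the symbol of the second kind with upper index \<open>k\<close>.\<close>

definition christoffel ::
    "('a, real ^ 'n) metric_field \<Rightarrow> ('a, real ^ 'n) chart \<Rightarrow> 'n \<Rightarrow> 'n \<Rightarrow> 'n \<Rightarrow> real ^ 'n::finite \<Rightarrow> real" where
  "christoffel g c k i j x =
     (\<Sum>l\<in>UNIV. matrix_inv (metric_matrix g c x) $ k $ l *
        (partial i (\<lambda>y. metric_matrix g c y $ j $ l) x +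
         partial j (\<lambda>y. metric_matrix g c y $ i $ l) x -
         partial l (\<lambda>y. metric_matrix g c y $ i $ j) x)) / 2"

text \<open>\<open>riemann g c m j k l\<close> is the component along the \<open>m\<close>-th coordinate field of
  \<open>R(\<partial>\<^sub>k, \<partial>\<^sub>l) \<partial>\<^sub>j\<close>, where
  \<open>R(X, Y) Z = \<nabla>\<^sub>X \<nabla>\<^sub>Y Z - \<nabla>\<^sub>Y \<nabla>\<^sub>X Z - \<nabla>\<^bsub>[X, Y]\<^esub> Z\<close>.\<close>

definition riemann ::
    "('a, real ^ 'n) metric_field \<Rightarrow> ('a, real ^ 'n) chart \<Rightarrow>
     'n \<Rightarrow> 'n \<Rightarrow> 'n \<Rightarrow> 'n \<Rightarrow> real ^ 'n::finite \<Rightarrow> real" where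
  "riemann g c m j k l x =
     partial k (christoffel g c m l j) x - partial l (christoffel g c m k j) x +
     (\<Sum>p\<in>UNIV. christoffel g c m k p x * christoffel g c p l j x -
               christoffel g c m l p x * christoffel g c p k j x)"

text \<open>The sectional curvature of the tangent plane,
  \<open>\<langle>R(\<partial>\<^sub>1, \<partial>\<^sub>2) \<partial>\<^sub>2, \<partial>\<^sub>1\<rangle> / (g\<^sub>1\<^sub>1 g\<^sub>2\<^sub>2 - g\<^sub>1\<^sub>2\<^sup>2)\<close>, computed in a chart \<open>c\<close> around \<open>p\<close>. It does not
  depend on that chart.\<close>

definition gaussian_curvature ::
    "('a, real ^ 2) metric_field \<Rightarrow> ('a, real ^ 2) chart \<Rightarrow> 'a \<Rightarrow> real" where
  "gaussian_curvature g c p =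
     (let x = snd c p
      in (\<Sum>m\<in>UNIV. metric_matrix g c x $ 1 $ m * riemann g c m 2 1 2 x) / det (metric_matrix g c x))"

definition constant_gaussian_curvature ::
    "('a, real ^ 2) chart set \<Rightarrow> ('a, real ^ 2) metric_field \<Rightarrow> real \<Rightarrow> bool" where
  "constant_gaussian_curvature A g \<kappa> \<longleftrightarrow> (\<forall>c\<in>A. \<forall>p\<in>fst c. gaussian_curvature g c p = \<kappa>)"

section \<open>Lie groups and translation surfaces\<close>

definition lie_group ::
    "('a, 'm) monoid_scheme \<Rightarrow> 'a topology \<Rightarrow> ('a, 'e::euclidean_space) chart set \<Rightarrow> bool" where
  "lie_group G X A \<longleftrightarrow> group G \<and> topspace X = carrier G \<and> smooth_manifold X A \<and>
     smooth_map (prod_topology X X) (prod_atlas A A) X A (\<lambda>(x, y). x \<otimes>\<^bsub>G\<^esub> y) \<and>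
     smooth_map X A X A (\<lambda>x. inv\<^bsub>G\<^esub> x)"

definition bi_invariant_metric ::
    "('a, 'm) monoid_scheme \<Rightarrow> ('a, 'e::euclidean_space) chart set \<Rightarrow> ('a, 'e) metric_field \<Rightarrow> bool" where
  "bi_invariant_metric G A g \<longleftrightarrow> riemannian_metric A g \<and>
     (\<forall>h\<in>carrier G. isometric A g A g (\<lambda>x. h \<otimes>\<^bsub>G\<^esub> x) \<and> isometric A g A g (\<lambda>x. x \<otimes>\<^bsub>G\<^esub> h))"

text \<open>A surface in \<open>G\<close> is a 2-manifold \<open>Y\<close> (with maximal atlas \<open>B\<close>) together with a map
  \<open>\<iota>\<close> to \<open>G\<close>, so that immersed surfaces with self-intersections are covered. A local
  parametrization \<open>f(s,t) = a(s) b(t)\<close> on a product of open intervals is the inverse of a chart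
  of \<open>Y\<close> followed by \<open>\<iota>\<close>.\<close>

definition translation_surface ::
    "('a, 'm) monoid_scheme \<Rightarrow> 'a topology \<Rightarrow> ('a, 'e::euclidean_space) chart set \<Rightarrow>
     's topology \<Rightarrow> ('s, real ^ 2) chart set \<Rightarrow> ('s \<Rightarrow> 'a) \<Rightarrow> bool" where
  "translation_surface G X A Y B \<iota> \<longleftrightarrow> smooth_manifold Y B \<and> smooth_map Y B X A \<iota> \<and>
     (\<forall>p\<in>topspace Y. \<exists>c\<in>B. \<exists>I J a b. p \<in> fst c \<and>
        smooth_curve I X A a \<and> smooth_curve J X A b \<and>
        snd c ` fst c = {x. x $ 1 \<in> I \<and> x $ 2 \<in> J} \<and>
        (\<forall>s\<in>I. \<forall>t\<in>J. \<iota> (inv_into (fst c) (snd c) (vector [s, t])) = a s \<otimes>\<^bsub>G\<^esub> b t))"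

text \<open>Immersivity of \<open>\<iota>\<close> is the same as immersivity of all its local parametrizations.\<close>

definition regular_translation_surface ::
    "('a, 'm) monoid_scheme \<Rightarrow> 'a topology \<Rightarrow> ('a, 'e::euclidean_space) chart set \<Rightarrow>
     's topology \<Rightarrow> ('s, real ^ 2) chart set \<Rightarrow> ('s \<Rightarrow> 'a) \<Rightarrow> bool" where
  "regular_translation_surface G X A Y B \<iota> \<longleftrightarrow>
     translation_surface G X A Y B \<iota> \<and> immersion Y B X A \<iota>"

end

theory Submission
  imports Defs
begin

text \<open>By bi-invariance the metric induced by \<open>f(s,t) = a(s) b(t)\<close> has the coefficients
  \<open>E = |a\<inverse> a'|\<^sup>2\<close>, \<open>G = |b' b\<inverse>|\<^sup>2\<close> and \<open>F = \<langle>a\<inverse> a', b' b\<inverse>\<rangle>\<close>, a finite sum of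
  products of a function of \<open>s\<close> and a function of \<open>t\<close>. With \<open>F = sqrt (E G) cos \<omega>\<close>, constant
  curvature \<open>K\<close> is the sine-Gordon equation \<open>\<omega>\<^sub>s\<^sub>t = - K sqrt (E G) sin \<omega>\<close>. Its conservation law
  \<open>(\<omega>\<^sub>s\<^sup>2)\<^sub>t = 2 K sqrt (E G) (cos \<omega>)\<^sub>s\<close> shows that for \<open>K \<noteq> 0\<close> the function \<open>W = \<omega>\<^sub>s\<^sup>2\<close> is
  also such a finite sum. Put \<open>u = (1 - cos \<omega>) / 2\<close> and \<open>v = 1 - u\<close>; then \<open>W = - (u\<^sub>s / u) (v\<^sub>s / v)\<close>.
  For any valuation (trivial on the constants) of a field containing the functions of \<open>t\<close>, and for
  generic \<open>s\<close>, the function \<open>u(s, _)\<close> has the minimal valuation in the finite-dimensional span of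
  the family \<open>u\<close>, which contains \<open>u\<^sub>s(s, _)\<close>; the same holds for \<open>v\<close>. So \<open>W(s, _)\<close> has
  nonnegative valuation everywhere, hence is constant in \<open>t\<close>. Then \<open>(cos \<omega>)\<^sub>s = 0\<close> at this \<open>s\<close>
  and the equation forces \<open>K = 0\<close>.\<close>

section \<open>An ultrapower of the reals\<close>

text \<open>Merely smooth functions of \<open>t\<close> do not lie in a field, since their ring has
  zero divisors. Restricting them to a sequence of parameters and passing to an ultrapower of the
  reals gives a field in which a denominator without zeros stays invertible. The sequence runs
  through distinct values of W at one fixed \<open>s\<close>; this makes W transcendental over the
  constants, so some valuation ring contains the reals but not W.

  Separability makes u, v and W linear images of one curve in a finite-dimensional space. That is
  why a minimal valuation exists, and why derivatives in \<open>s\<close>, being limits inside a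
  closed subspace, cannot fall below it. The difficulty is circular: the valuation is built from a
  pole at one \<open>s\<close>, while integrality holds only at parameters generic for this
  valuation. The pole must be carried from the former to the latter. For analytic curves the
  identity theorem would do this; for smooth ones the interval is first shrunk until the span of the
  curve can drop no further.\<close>

lemma exists_free_ultrafilter:
  "\<exists>U. U \<noteq> bot \<and> U \<le> cofinite \<and> (\<forall>P. eventually P U \<or> eventually (\<lambda>n::nat. \<not> P n) U)"
proof -
  \<comment> \<open>Only closure under intersection is demanded; closure under supersets is
    recovered from maximality in \<open>mono\<close>.\<close>
  let ?C = "\<lambda>K. {S. K \<subseteq> S \<and> {} \<notin> S \<and> (\<forall>A\<in>S. \<forall>B\<in>S. A \<inter> B \<in> S)}"
  define K :: "nat set set" where "K = {A. finite (- A)}"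
  have "\<exists>S\<in>?C K. \<forall>X\<in>?C K. S \<subseteq> X \<longrightarrow> X = S"
  proof (rule subset_Zorn_nonempty)
    have "K \<in> ?C K" by (auto simp: K_def Compl_Int)
    then show "?C K \<noteq> {}" by blast
    fix C assume ne: "C \<noteq> {}" and ch: "subset.chain (?C K) C"
    have two: "\<exists>R\<in>C. x \<in> R \<and> y \<in> R" if "x \<in> \<Union>C" "y \<in> \<Union>C" for x y
      using that ch unfolding subset.chain_def by blast
    have "A \<inter> B \<in> \<Union>C" if "A \<in> \<Union>C" "B \<in> \<Union>C" for A B
      using two[OF that] ch by (auto simp: subset.chain_def)
    moreover have "K \<subseteq> R" "{} \<notin> R" if "R \<in> C" for R
      using that ch by (auto simp: subset.chain_def)
    then have "K \<subseteq> \<Union>C" "{} \<notin> \<Union>C" using ne by auto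
    ultimately show "\<Union>C \<in> ?C K" by auto
  qed
  then obtain S where S: "K \<subseteq> S" "{} \<notin> S" "\<And>A B. A \<in> S \<Longrightarrow> B \<in> S \<Longrightarrow> A \<inter> B \<in> S"
    and max: "\<And>X. X \<in> ?C K \<Longrightarrow> S \<subseteq> X \<Longrightarrow> X = S" by (smt (verit) mem_Collect_eq)
  \<comment> \<open>A set that meets every member can be adjoined together with its traces on the
    members without producing the empty set, so a maximal family already contains it.\<close>
  have ultra: "A \<in> S" if "\<And>B. B \<in> S \<Longrightarrow> A \<inter> B \<noteq> {}" for A
  proof -
    let ?X = "S \<union> {A \<inter> B | B. B \<in> S}"
    have "UNIV \<in> S" using S by (auto simp: K_def)
    have XC: "?X \<in> ?C K"
    proof (intro CollectI conjI ballI)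
      show "K \<subseteq> ?X" "{} \<notin> ?X" using S(1,2) that by blast+
      fix P Q assume "P \<in> ?X" "Q \<in> ?X"
      then consider "P \<in> S" "Q \<in> S" | B where "P \<in> S" "Q = A \<inter> B" "B \<in> S"
        | B where "Q \<in> S" "P = A \<inter> B" "B \<in> S"
        | B B' where "P = A \<inter> B" "B \<in> S" "Q = A \<inter> B'" "B' \<in> S" by blast
      then show "P \<inter> Q \<in> ?X"
      proof cases
        case 2 then show ?thesis using S(3)[of P B] by (auto intro!: exI[of _ "P \<inter> B"])
      next
        case 3 then show ?thesis using S(3)[of Q B] by (auto intro!: exI[of _ "Q \<inter> B"])
      next
        case 4 then show ?thesis using S(3)[of B B'] by (auto intro!: exI[of _ "B \<inter> B'"])
      qed (use S in auto)
    qed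
    have "?X = S" by (rule max[OF XC]) simp
    moreover have "A \<in> ?X" using \<open>UNIV \<in> S\<close> by blast
    ultimately show ?thesis by simp
  qed
  have mono: "B \<in> S" if "A \<in> S" "A \<subseteq> B" for A B
  proof (rule ultra)
    fix C assume "C \<in> S"
    then have "A \<inter> C \<noteq> {}" using S(3)[OF that(1)] S(2) by metis
    then show "B \<inter> C \<noteq> {}" using that(2) by auto
  qed
  define U where "U = Abs_filter (\<lambda>P. Collect P \<in> S)"
  have ev: "eventually P U \<longleftrightarrow> Collect P \<in> S" for P
    unfolding U_def
  proof (rule eventually_Abs_filter, rule is_filter.intro)
    show "Collect (\<lambda>x. True) \<in> S" using S by (auto simp: K_def)
    show "Collect (\<lambda>x. P x \<and> Q x) \<in> S" if "Collect P \<in> S" "Collect Q \<in> S" for P Q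
      using S(3)[OF that] by (simp add: Collect_conj_eq)
    show "Collect Q \<in> S" if "\<forall>x. P x \<longrightarrow> Q x" "Collect P \<in> S" for P Q
      using mono[OF that(2)] that(1) by blast
  qed
  show ?thesis
  proof (intro exI[of _ U] conjI allI)
    show "U \<noteq> bot" using S(2) by (simp add: trivial_limit_def ev)
    show "U \<le> cofinite"
      using S(1) by (auto simp: le_filter_def eventually_cofinite ev K_def Collect_neg_eq[symmetric] subset_iff)
    show "eventually P U \<or> eventually (\<lambda>n. \<not> P n) U" for P
    proof (rule disjCI)
      assume "\<not> eventually (\<lambda>n. \<not> P n) U"
      then have n: "{n. \<not> P n} \<notin> S" by (simp add: ev)
      show "eventually P U" unfolding ev
      proof (rule ultra)
        fix B assume "B \<in> S"
        then show "Collect P \<inter> B \<noteq> {}" using mono[of B "{n. \<not> P n}"] n by auto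
      qed
    qed
  qed
qed

definition free_ultra :: "nat filter" where
  "free_ultra = (SOME U. U \<noteq> bot \<and> U \<le> cofinite \<and>
     (\<forall>P. eventually P U \<or> eventually (\<lambda>n. \<not> P n) U))"

lemma free_ultra:
  "free_ultra \<noteq> bot" "free_ultra \<le> cofinite"
  "eventually P free_ultra \<or> eventually (\<lambda>n. \<not> P n) free_ultra"
  using someI_ex[OF exists_free_ultrafilter] unfolding free_ultra_def by blast+

quotient_type hyperreal = "nat \<Rightarrow> real" / "\<lambda>x y. eventually (\<lambda>n. x n = y n) free_ultra"
  morphisms rep_hyper hyper
proof (rule equivpI)
  show "reflp (\<lambda>x y. \<forall>\<^sub>F n in free_ultra. x n = y n)" by (simp add: reflp_def)
  show "symp (\<lambda>x y. \<forall>\<^sub>F n in free_ultra. x n = y n)" by (simp add: symp_def eq_commute)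
  show "transp (\<lambda>x y. \<forall>\<^sub>F n in free_ultra. x n = y n)"
    by (auto simp: transp_def elim: eventually_elim2)
qed

instantiation hyperreal :: field
begin

lift_definition zero_hyperreal :: hyperreal is "\<lambda>n. 0" .
lift_definition one_hyperreal :: hyperreal is "\<lambda>n. 1" .
lift_definition plus_hyperreal :: "hyperreal \<Rightarrow> hyperreal \<Rightarrow> hyperreal" is "\<lambda>x y n. x n + y n"
  by (auto elim: eventually_elim2)
lift_definition minus_hyperreal :: "hyperreal \<Rightarrow> hyperreal \<Rightarrow> hyperreal" is "\<lambda>x y n. x n - y n"
  by (auto elim: eventually_elim2)
lift_definition times_hyperreal :: "hyperreal \<Rightarrow> hyperreal \<Rightarrow> hyperreal" is "\<lambda>x y n. x n * y n"
  by (auto elim: eventually_elim2)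
lift_definition divide_hyperreal :: "hyperreal \<Rightarrow> hyperreal \<Rightarrow> hyperreal" is "\<lambda>x y n. x n / y n"
  by (auto elim: eventually_elim2)
lift_definition uminus_hyperreal :: "hyperreal \<Rightarrow> hyperreal" is "\<lambda>x n. - x n"
  by (auto elim: eventually_mono)
lift_definition inverse_hyperreal :: "hyperreal \<Rightarrow> hyperreal" is "\<lambda>x n. inverse (x n)"
  by (auto elim: eventually_mono)

instance
proof
  fix a b c :: hyperreal
  show "a * b * c = a * (b * c)" "a * b = b * a" "1 * a = a" "a + b + c = a + (b + c)"
    "a + b = b + a" "0 + a = a" "- a + a = 0" "a - b = a + - b" "(a + b) * c = a * c + b * c"
    "a div b = a * inverse b" "inverse 0 = (0 :: hyperreal)"
    by (transfer, simp add: algebra_simps divide_inverse)+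
  show "(0 :: hyperreal) \<noteq> 1" by transfer (simp add: free_ultra(1))
  \<comment> \<open>The one field axiom that uses the ultra property: a sequence that is not almost
    everywhere zero is almost everywhere nonzero.\<close>
  show "a \<noteq> 0 \<Longrightarrow> inverse a * a = 1"
  proof transfer
    fix x :: "nat \<Rightarrow> real" assume "\<not> (\<forall>\<^sub>F n in free_ultra. x n = 0)"
    then have "\<forall>\<^sub>F n in free_ultra. x n \<noteq> 0" using free_ultra(3) by blast
    then show "\<forall>\<^sub>F n in free_ultra. inverse (x n) * x n = 1" by (auto elim: eventually_mono)
  qed
qed

end

lemma hyper_arith:
  "hyper x + hyper y = hyper (\<lambda>n. x n + y n)" "hyper x - hyper y = hyper (\<lambda>n. x n - y n)"
  "hyper x * hyper y = hyper (\<lambda>n. x n * y n)" "hyper x / hyper y = hyper (\<lambda>n. x n / y n)"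
  "- hyper x = hyper (\<lambda>n. - x n)" "inverse (hyper x) = hyper (\<lambda>n. inverse (x n))"
  "1 = hyper (\<lambda>n. 1)" "0 = hyper (\<lambda>n. 0)"
  by (simp_all add: plus_hyperreal.abs_eq minus_hyperreal.abs_eq times_hyperreal.abs_eq
      divide_hyperreal.abs_eq uminus_hyperreal.abs_eq inverse_hyperreal.abs_eq
      one_hyperreal_def zero_hyperreal_def)

lemma hyper_eq_iff: "hyper x = hyper y \<longleftrightarrow> eventually (\<lambda>n. x n = y n) free_ultra"
  by (rule hyperreal.abs_eq_iff)

lemma hyper_neI: "(\<And>n. x n \<noteq> y n) \<Longrightarrow> hyper x \<noteq> hyper y"
  by (simp add: hyper_eq_iff free_ultra(1))

section \<open>Existence of valuation rings\<close>

definition is_subring :: "'a::field set \<Rightarrow> bool" where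
  "is_subring R \<longleftrightarrow> 1 \<in> R \<and> (\<forall>x\<in>R. \<forall>y\<in>R. x - y \<in> R \<and> x * y \<in> R)"

lemma is_subringD:
  assumes "is_subring R"
  shows "1 \<in> R" "0 \<in> R" "x \<in> R \<Longrightarrow> y \<in> R \<Longrightarrow> x - y \<in> R" "x \<in> R \<Longrightarrow> y \<in> R \<Longrightarrow> x * y \<in> R"
    "x \<in> R \<Longrightarrow> - x \<in> R" "x \<in> R \<Longrightarrow> y \<in> R \<Longrightarrow> x + y \<in> R"
proof -
  show 1: "1 \<in> R" and d: "x \<in> R \<Longrightarrow> y \<in> R \<Longrightarrow> x - y \<in> R"
    and m: "x \<in> R \<Longrightarrow> y \<in> R \<Longrightarrow> x * y \<in> R" for x y
    using assms by (auto simp: is_subring_def)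
  show z: "0 \<in> R" using d[OF 1 1] by simp
  show n: "x \<in> R \<Longrightarrow> - x \<in> R" for x using d[OF z, of x] by simp
  show "x \<in> R \<Longrightarrow> y \<in> R \<Longrightarrow> x + y \<in> R" for x y using d[OF _ n, of x y] by simp
qed

lemma is_subring_sum:
  assumes "is_subring R" "\<And>i. i \<in> A \<Longrightarrow> f i \<in> R"
  shows "sum f A \<in> R"
  using assms(2) by (induction A rule: infinite_finite_induct)
    (auto simp: is_subringD[OF assms(1)])

lemma is_subring_power: "is_subring R \<Longrightarrow> x \<in> R \<Longrightarrow> x ^ n \<in> R"
  by (induction n) (auto simp: is_subringD)

text \<open>The descent in Chevalley's extension theorem: relations \<open>1 = p(x)\<close> and
  \<open>1 = q(1/x)\<close> with coefficients in \<open>M\<close> of minimal degree would reduce each other.\<close>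

lemma no_two_sided_relation:
  fixes x :: "'a::field"
  assumes M_add: "\<And>a b. a \<in> M \<Longrightarrow> b \<in> M \<Longrightarrow> a + b \<in> M" and M0: "0 \<in> M" and M1: "1 \<notin> M"
    and M_div: "\<And>a b c. a \<in> M \<Longrightarrow> b \<in> M \<Longrightarrow> c \<in> M \<Longrightarrow> a * b / (1 - c) \<in> M"
    and "x \<noteq> 0" "\<And>i. coeff p i \<in> M" "\<And>i. coeff q i \<in> M" "poly p x = 1" "poly q (inverse x) = 1"
  shows False
  using assms(5-9)
proof (induction "degree p + degree q" arbitrary: p q x rule: less_induct)
  case less
  \<comment> \<open>The situation is symmetric under exchanging \<open>x\<close> with its inverse,
    so \<open>p\<close> may be taken of the larger degree. The relation for \<open>q\<close>,
    multiplied by \<open>x ^ m\<close>, writes \<open>(1 - c) * x ^ m\<close> in lower powers of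
    \<open>x\<close>, which removes the leading term of \<open>p\<close>.\<close>
  have wlog: False if x: "x \<noteq> 0" and p: "\<And>i. coeff p i \<in> M" and q: "\<And>i. coeff q i \<in> M"
    and px: "poly p x = 1" and qx: "poly q (inverse x) = 1" and le: "degree q \<le> degree p"
    and IH: "\<And>p'. degree p' < degree p \<Longrightarrow> (\<And>i. coeff p' i \<in> M) \<Longrightarrow> poly p' x = 1 \<Longrightarrow> False"
    for p q x
  proof -
    define n m c where "n = degree p" and "m = degree q" and "c = coeff q 0"
    \<comment> \<open>A constant \<open>q\<close> would be the constant 1, which is not in
      \<open>M\<close>.\<close>
    have "degree q \<noteq> 0"
    proof
      assume "degree q = 0"
      then obtain k where "q = [:k:]" using degree_eq_zeroE by blast
      then show False using qx q[of 0] M1 by simp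
    qed
    then have n0: "n > 0" and m0: "m > 0" and mn: "m \<le> n" using le by (auto simp: n_def m_def)
    have c1: "1 - c \<noteq> 0" using q[of 0] M1 by (auto simp: c_def)
    define R where "R = (\<Sum>j=1..m. monom (coeff q j) (m - j))"
    have "x ^ m = x ^ m * (\<Sum>j\<le>m. coeff q j * inverse x ^ j)"
      using qx by (simp add: poly_altdef m_def)
    also have "\<dots> = (\<Sum>j\<le>m. coeff q j * x ^ (m - j))"
      unfolding sum_distrib_left
      by (rule sum.cong) (auto simp: power_diff x field_simps)
    also have "\<dots> = c * x ^ m + (\<Sum>j=1..m. coeff q j * x ^ (m - j))"
      by (subst atMost_atLeast0, subst sum.atLeast_Suc_atMost) (auto simp: c_def)
    finally have xm: "(1 - c) * x ^ m = poly R x"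
      by (simp add: R_def poly_sum poly_monom algebra_simps)
    define d where "d = lead_coeff p / (1 - c)"
    \<comment> \<open>The leading monomial is replaced through
      \<open>x ^ n = x ^ (n - m) * x ^ m\<close>. The new coefficients are products
      \<open>d * coeff q j\<close>, for which \<open>M_div\<close> has its shape.\<close>
    define p' where "p' = p - monom (lead_coeff p) n + smult d (monom 1 (n - m) * R)"
    have coeffR: "coeff R i = (if i < m then coeff q (m - i) else 0)" for i
    proof -
      have "coeff R i = (\<Sum>j=1..m. if m - j = i then coeff q j else 0)"
        by (simp add: R_def coeff_sum)
      also have "\<dots> = (\<Sum>j\<in>{1..m}. if j = m - i \<and> i < m then coeff q j else 0)"
        by (rule sum.cong) auto
      also have "\<dots> = (if i < m then coeff q (m - i) else 0)"
        by (cases "i < m") (auto simp: sum.delta)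
      finally show ?thesis .
    qed
    have cp': "coeff p' i = (if i = n then 0 else coeff p i) +
        d * (if i < n - m then 0 else coeff R (i - (n - m)))" for i
      by (auto simp: p'_def coeff_monom_mult n_def)
    have "degree p' < n"
    proof (rule degree_lessI)
      show "p' \<noteq> 0 \<or> n > 0" using n0 by simp
      show "\<forall>k\<ge>n. coeff p' k = 0"
        using mn by (auto simp: cp' coeffR n_def coeff_eq_0)
    qed
    moreover have "coeff p' i \<in> M" for i
    proof -
      have "d * coeff q j \<in> M" for j
        using M_div[OF p[of n] q[of j] q[of 0]] by (simp add: d_def c_def n_def)
      then have "d * (if i < n - m then 0 else coeff R (i - (n - m))) \<in> M"
        using M0 by (auto simp: coeffR)
      then show ?thesis unfolding cp' using M0 p[of i] M_add by auto
    qed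
    moreover have "poly p' x = 1"
    proof -
      have "d * (x ^ (n - m) * poly R x) = lead_coeff p * (x ^ (n - m) * x ^ m)"
        using c1 by (simp add: xm[symmetric] d_def)
      also have "x ^ (n - m) * x ^ m = x ^ n" using mn by (simp flip: power_add)
      finally show ?thesis by (simp add: p'_def poly_monom px)
    qed
    ultimately show False using IH[of p'] by (auto simp: n_def)
  qed
  show False
  proof (cases "degree q \<le> degree p")
    case True
    show ?thesis
      by (rule wlog[of x p q]) (use less True in \<open>auto intro: less(1)[of _ q x]\<close>)
  next
    case False
    show ?thesis
      by (rule wlog[of "inverse x" q p])
        (use less False in \<open>auto intro: less(1)[of p _ x]\<close>)
  qed
qed

text \<open>Chevalley's argument: a subring maximal among those that contain \<open>R0\<close> and
  omit \<open>w\<close> is a valuation ring. If neither \<open>x\<close> nor its inverse were in it,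
  adjoining either one would capture \<open>w\<close>, and multiplying by \<open>inverse w\<close>
  gives the two relations excluded by \<open>no_two_sided_relation\<close>.\<close>

lemma exists_valuation_ring:
  fixes w :: "'a::field"
  assumes "is_subring R0" "inverse w \<in> R0" "w \<notin> R0"
  obtains V where "is_subring V" "R0 \<subseteq> V" "w \<notin> V" "\<And>x. x \<in> V \<or> inverse x \<in> V"
proof -
  let ?C = "{R. is_subring R \<and> R0 \<subseteq> R \<and> w \<notin> R}"
  have "\<exists>V\<in>?C. \<forall>X\<in>?C. V \<subseteq> X \<longrightarrow> X = V"
  proof (rule subset_Zorn_nonempty)
    show "?C \<noteq> {}" using assms by auto
    fix C assume ne: "C \<noteq> {}" and ch: "subset.chain ?C C"
    have two: "\<exists>R\<in>C. x \<in> R \<and> y \<in> R" if "x \<in> \<Union>C" "y \<in> \<Union>C" for x y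
      using that ch unfolding subset.chain_def by blast
    have sub: "is_subring R" if "R \<in> C" for R using that ch by (auto simp: subset.chain_def)
    have "is_subring (\<Union>C)"
      unfolding is_subring_def
    proof (intro conjI ballI)
      show "1 \<in> \<Union>C" using ne sub is_subringD(1) by blast
      fix x y assume "x \<in> \<Union>C" "y \<in> \<Union>C"
      then obtain R where "R \<in> C" "x \<in> R" "y \<in> R" using two by blast
      then show "x - y \<in> \<Union>C" "x * y \<in> \<Union>C" using sub is_subringD by blast+
    qed
    then show "\<Union>C \<in> ?C" using ne ch by (auto simp: subset.chain_def)
  qed
  then obtain V where V: "is_subring V" "R0 \<subseteq> V" "w \<notin> V"
    and max: "\<And>R. is_subring R \<Longrightarrow> V \<subseteq> R \<Longrightarrow> w \<notin> R \<Longrightarrow> R = V"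
    by (smt (verit) mem_Collect_eq order_trans)
  note D = is_subringD[OF V(1)]
  define m where "m = inverse w"
  have w0: "w \<noteq> 0" using V(3) D(2) by metis
  have m: "m \<in> V" "m \<noteq> 0" "m * w = 1" using assms V w0 by (auto simp: m_def)
  \<comment> \<open>Inverting \<open>y = 1 - m * u\<close> cannot capture \<open>w\<close>: powers
    of \<open>y\<close> have the form \<open>1 - m * t\<close>, so \<open>w = z / y ^ k\<close>
    would give \<open>w = z + t\<close> in \<open>V\<close>. By maximality the inverse of
    \<open>y\<close> is already in \<open>V\<close>.\<close>
  have unit: "inverse (1 - m * u) \<in> V" and nz: "1 - m * u \<noteq> 0" if u: "u \<in> V" for u
  proof -
    define y where "y = 1 - m * u"
    have y: "y \<in> V" using u m D by (auto simp: y_def)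
    show y0: "1 - m * u \<noteq> 0"
    proof
      assume "1 - m * u = 0"
      then have "w = u" using m by (metis eq_iff_diff_eq_0 mult_cancel_left)
      then show False using u V by simp
    qed
    let ?R = "{z / y ^ k | z k. z \<in> V}"
    have R: "is_subring ?R"
      unfolding is_subring_def
    proof (intro conjI ballI)
      show "1 \<in> ?R" by (rule CollectI, rule exI[of _ 1], rule exI[of _ 0]) (simp add: D(1))
      fix a b assume "a \<in> ?R" "b \<in> ?R"
      then obtain z k z' k' where ab: "a = z / y ^ k" "b = z' / y ^ k'" "z \<in> V" "z' \<in> V" by blast
      have "a - b = (z * y ^ k' - z' * y ^ k) / y ^ (k + k')"
        using y0 by (simp add: ab y_def power_add divide_simps)
      moreover have "z * y ^ k' - z' * y ^ k \<in> V"
        using ab y by (intro D is_subring_power V)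
      ultimately show "a - b \<in> ?R" by blast
      have "a * b = (z * z') / y ^ (k + k')" by (simp add: ab power_add)
      then show "a * b \<in> ?R" using ab D(4) by blast
    qed
    have VR: "V \<subseteq> ?R"
    proof
      fix v assume "v \<in> V"
      then show "v \<in> ?R" by (intro CollectI exI[of _ v] exI[of _ 0]) simp
    qed
    have "w \<notin> ?R"
    proof
      assume "w \<in> ?R"
      then obtain z k where z: "w = z / y ^ k" "z \<in> V" by blast
      have "\<exists>t\<in>V. y ^ k = 1 - m * t" for k
      proof (induction k)
        case (Suc k)
        then obtain t where t: "t \<in> V" "y ^ k = 1 - m * t" by blast
        have "y ^ Suc k = 1 - m * (u + t - m * u * t)"
          unfolding power_Suc t(2) by (simp add: y_def algebra_simps)
        moreover have "u + t - m * u * t \<in> V" by (intro D t u m)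
        ultimately show ?case by blast
      next
        case 0
        show ?case by (rule bexI[of _ 0]) (simp_all add: D(2))
      qed
      then obtain t where t: "t \<in> V" "y ^ k = 1 - m * t" by blast
      have "z = w * y ^ k" using z y0 by (simp add: y_def)
      also have "\<dots> = w - m * w * t" unfolding t(2) by (simp add: algebra_simps)
      also have "\<dots> = w - t" by (simp add: m)
      finally have "w = z + t" by simp
      then show False using D(6)[OF z(2) t(1)] V(3) by simp
    qed
    then have "?R = V" using max R VR by blast
    moreover have "inverse y \<in> ?R"
      by (intro CollectI exI[of _ 1]) (simp add: divide_inverse D(1))
    ultimately show "inverse (1 - m * u) \<in> V" by (simp add: y_def)
  qed
  let ?M = "{m * u | u. u \<in> V}"
  \<comment> \<open>The ring generated by \<open>V\<close> and \<open>x\<close> properly contains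
    \<open>V\<close>, hence contains \<open>w\<close>. Multiplying \<open>w = poly p x\<close> by
    \<open>m\<close> gives the value 1 and moves the coefficients into \<open>?M\<close>.\<close>
  have rel: "\<exists>p. (\<forall>i. coeff p i \<in> ?M) \<and> poly p x = 1" if x: "x \<notin> V" for x
  proof -
    let ?R = "{poly p x | p. \<forall>i. coeff p i \<in> V}"
    have "is_subring ?R"
      unfolding is_subring_def
    proof (intro conjI ballI)
      show "1 \<in> ?R"
        by (intro CollectI exI[of _ "[:1:]"]) (auto simp: coeff_pCons D(1) D(2) split: nat.split)
      fix a b assume "a \<in> ?R" "b \<in> ?R"
      then obtain p q where pq: "a = poly p x" "b = poly q x" "\<forall>i. coeff p i \<in> V" "\<forall>i. coeff q i \<in> V"
        by blast
      show "a - b \<in> ?R" by (intro CollectI exI[of _ "p - q"]) (simp add: pq D(3))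
      have "coeff (p * q) i \<in> V" for i
        unfolding coeff_mult using pq by (intro is_subring_sum V D) auto
      then show "a * b \<in> ?R" by (intro CollectI exI[of _ "p * q"]) (simp add: pq)
    qed
    moreover have "V \<subseteq> ?R"
    proof
      fix v assume "v \<in> V"
      then show "v \<in> ?R"
        by (intro CollectI exI[of _ "[:v:]"]) (auto simp: coeff_pCons D(2) split: nat.split)
    qed
    moreover have "x \<in> ?R"
      by (intro CollectI exI[of _ "[:0, 1:]"])
        (auto simp: coeff_pCons D(1) D(2) split: nat.split)
    ultimately have "w \<in> ?R" using max x by blast
    then obtain p where p: "w = poly p x" "\<And>i. coeff p i \<in> V" by blast
    then show ?thesis using m by (intro exI[of _ "smult m p"]) auto
  qed
  show thesis
  proof (rule that[OF V])
    show "x \<in> V \<or> inverse x \<in> V" for x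
    proof (rule ccontr)
      assume "\<not> ?thesis"
      then have x: "x \<notin> V" "inverse x \<notin> V" by auto
      obtain p q where p: "\<And>i. coeff p i \<in> ?M" "poly p x = 1"
        and q: "\<And>i. coeff q i \<in> ?M" "poly q (inverse x) = 1"
        using rel[OF x(1)] rel[OF x(2)] by blast
      show False
      proof (rule no_two_sided_relation[of ?M x p q])
        show "a + b \<in> ?M" if "a \<in> ?M" "b \<in> ?M" for a b
          using that by (auto simp flip: distrib_left intro: D(6))
        show "0 \<in> ?M" using D(2) by force
        show "1 \<notin> ?M" using nz by auto
        show "a * b / (1 - c) \<in> ?M" if abc: "a \<in> ?M" "b \<in> ?M" "c \<in> ?M" for a b c
        proof -
          obtain u v t where uvt: "a = m * u" "b = m * v" "c = m * t" "u \<in> V" "v \<in> V" "t \<in> V"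
            using abc by blast
          have "a * b / (1 - c) = m * (u * (m * v) * inverse (1 - m * t))"
            by (simp add: uvt divide_inverse)
          moreover have "u * (m * v) * inverse (1 - m * t) \<in> V"
            by (intro D(4) m unit uvt)
          ultimately show ?thesis by blast
        qed
        show "x \<noteq> 0" using x(1) D(2) by metis
      qed (use p q in auto)
    qed
  qed
qed

section \<open>Generic parameters of a curve\<close>

text \<open>A substitute for analyticity. A smooth curve may run inside a proper subspace for a
  while and then leave it; on an interval of this kind it stays in a subspace on a subinterval only
  if it lies there throughout.\<close>

definition stable_span :: "(real \<Rightarrow> 'v::euclidean_space) \<Rightarrow> real \<Rightarrow> real \<Rightarrow> bool" where
  "stable_span x l r \<longleftrightarrow> l < r \<and>
     (\<forall>l' r'. l \<le> l' \<longrightarrow> l' < r' \<longrightarrow> r' \<le> r \<longrightarrow> span (x ` {l'<..<r'}) = span (x ` {l<..<r}))"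

lemma stable_span_subinterval:
  assumes "stable_span x l r" "l \<le> l'" "l' < r'" "r' \<le> r"
  shows "stable_span x l' r'"
  unfolding stable_span_def
proof (intro conjI allI impI)
  fix l'' r'' assume "l' \<le> l''" "l'' < r''" "r'' \<le> r'"
  then have "span (x ` {l''<..<r''}) = span (x ` {l<..<r})"
    using assms unfolding stable_span_def by (meson order_trans)
  moreover have "span (x ` {l'<..<r'}) = span (x ` {l<..<r})"
    using assms unfolding stable_span_def by blast
  ultimately show "span (x ` {l''<..<r''}) = span (x ` {l'<..<r'})" by simp
qed (fact assms)

text \<open>A subinterval on which the image has the least dimension works, because passing to a
  smaller one can only lose dimension.\<close>

lemma stable_span_exists:
  fixes x :: "real \<Rightarrow> 'v::euclidean_space"
  assumes "l < r"
  obtains l' r' where "l \<le> l'" "r' \<le> r" "stable_span x l' r'"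
proof -
  let ?P = "\<lambda>(l', r'). l \<le> l' \<and> l' < r' \<and> r' \<le> r"
  let ?d = "\<lambda>(l', r'). dim (x ` {l'<..<r'})"
  obtain p where p: "?P p" "\<And>q. ?P q \<Longrightarrow> ?d p \<le> ?d q"
    using ex_has_least_nat[of ?P "(l, r)" ?d] assms by auto
  obtain l' r' where [simp]: "p = (l', r')" by (cases p)
  have "span (x ` {l''<..<r''}) = span (x ` {l'<..<r'})"
    if "l' \<le> l''" "l'' < r''" "r'' \<le> r'" for l'' r''
  proof (rule dim_eq_span)
    show "x ` {l''<..<r''} \<subseteq> x ` {l'<..<r'}" using that by auto
    show "dim (x ` {l'<..<r'}) \<le> dim (x ` {l''<..<r''})"
      using p(2)[of "(l'', r'')"] p(1) that by simp
  qed
  moreover have p1: "l \<le> l'" "l' < r'" "r' \<le> r" using p(1) by auto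
  ultimately have "stable_span x l' r'" unfolding stable_span_def by blast
  then show thesis using that p1 by blast
qed

text \<open>Equality of spans carries \<open>out\<close> from the large interval to the small one;
  then the complement of the closed set \<open>H\<close> is open. Two intervals appear so that a
  fact observed at a parameter fixed early survives all later shrinkings.\<close>

lemma stable_span_avoid:
  assumes st: "stable_span x l r" and cont: "continuous_on {l<..<r} x"
    and H: "subspace H" and out: "\<not> x ` {l0<..<r0} \<subseteq> H" and sub: "l0 \<le> l" "r \<le> r0"
    and st0: "stable_span x l0 r0"
  obtains l' r' where "l \<le> l'" "r' \<le> r" "stable_span x l' r'" "\<And>s. s \<in> {l'<..<r'} \<Longrightarrow> x s \<notin> H"
proof -
  have lr: "l < r" using st by (simp add: stable_span_def)
  have "span (x ` {l<..<r}) = span (x ` {l0<..<r0})"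
    using st0 sub lr unfolding stable_span_def by blast
  have "\<not> x ` {l<..<r} \<subseteq> H"
  proof
    assume "x ` {l<..<r} \<subseteq> H"
    then have "span (x ` {l<..<r}) \<subseteq> H" using H by (rule span_minimal)
    then show False using out \<open>span _ = span _\<close> span_superset by blast
  qed
  then obtain s where s: "s \<in> {l<..<r}" "x s \<notin> H" by blast
  have "open ({l<..<r} \<inter> x -` (- H))"
    by (intro continuous_open_preimage cont) (simp_all add: closed_subspace H open_Compl)
  moreover have "s \<in> {l<..<r} \<inter> x -` (- H)" using s by simp
  ultimately obtain e where e: "e > 0" "ball s e \<subseteq> {l<..<r} \<inter> x -` (- H)"
    using open_contains_ball by blast
  have be: "ball s e = {s - e<..<s + e}" by (auto simp: ball_def dist_real_def)
  have b: "l \<le> s - e \<and> s + e \<le> r"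
  proof -
    have "{s - e<..<s + e} \<subseteq> {l<..<r}" using e be by auto
    then show ?thesis using e(1) by (auto simp: greaterThanLessThan_subseteq_greaterThanLessThan)
  qed
  show thesis
  proof (rule that)
    show "stable_span x (s - e) (s + e)" using stable_span_subinterval[OF st] b e by auto
    show "x u \<notin> H" if "u \<in> {s - e<..<s + e}" for u using that e be by auto
  qed (use b in auto)
qed

lemma vector_derivative_in_subspace:
  fixes x :: "real \<Rightarrow> 'v::euclidean_space"
  assumes "(x has_vector_derivative v) (at s)" "subspace H" "s \<in> {l<..<r}"
    and "\<And>u. u \<in> {l<..<r} \<Longrightarrow> x u \<in> H"
  shows "v \<in> H"
proof (rule Lim_in_closed_set)
  show "closed H" using assms by (simp add: closed_subspace)
  let ?q = "\<lambda>y. (1 / norm (y - s)) *\<^sub>R (x y - (x s + (y - s) *\<^sub>R v))"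
  have "(?q \<longlongrightarrow> 0) (at s)"
    using assms(1) by (simp add: has_vector_derivative_def has_derivative_within)
  \<comment> \<open>The Frechet quotient divides by \<open>norm (y - s)\<close>; the sign turns this
    into division by \<open>y - s\<close>.\<close>
  then have "((\<lambda>y. sgn (y - s) *\<^sub>R ?q y) \<longlongrightarrow> 0) (at s)"
    by (rule Lim_null_comparison[rotated, OF tendsto_norm_zero])
      (auto simp: sgn_if intro!: always_eventually)
  then have "((\<lambda>y. sgn (y - s) *\<^sub>R ?q y + v) \<longlongrightarrow> 0 + v) (at s)"
    by (rule tendsto_add) simp
  moreover have "\<forall>\<^sub>F y in at s. sgn (y - s) *\<^sub>R ?q y + v = (x y - x s) /\<^sub>R (y - s)"
    unfolding eventually_at_filter
  proof (intro always_eventually allI impI)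
    fix y assume "y \<noteq> s"
    then have "sgn (y - s) * (1 / norm (y - s)) = 1 / (y - s)"
      by (cases "y < s") (auto simp: sgn_if field_simps)
    then have "sgn (y - s) *\<^sub>R ?q y = (1 / (y - s)) *\<^sub>R (x y - (x s + (y - s) *\<^sub>R v))"
      by simp
    also have "\<dots> = (1 / (y - s)) *\<^sub>R (x y - x s) - v"
      using \<open>y \<noteq> s\<close> by (simp add: diff_diff_eq[symmetric] scaleR_diff_right[of "1 / (y - s)" _ "(y - s) *\<^sub>R v"])
    finally show "sgn (y - s) *\<^sub>R ?q y + v = (x y - x s) /\<^sub>R (y - s)" by (simp add: divide_inverse)
  qed
  ultimately show "((\<lambda>y. (x y - x s) /\<^sub>R (y - s)) \<longlongrightarrow> v) (at s)"
    by (simp add: tendsto_cong)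
  have "\<forall>\<^sub>F y in at s. y \<in> {l<..<r}"
    using assms(3) by (intro eventually_at_in_open') auto
  then show "\<forall>\<^sub>F y in at s. (x y - x s) /\<^sub>R (y - s) \<in> H"
    by eventually_elim (intro subspace_scale subspace_diff assms, auto simp: assms)
qed simp

text \<open>At a generic parameter the coordinate vector \<open>x s\<close> has the minimal valuation among all
  vectors of the curve, hence also among all its derivatives.\<close>

lemma generic_log_derivative_integral:
  fixes x :: "real \<Rightarrow> 'v::euclidean_space" and \<Phi> :: "'v \<Rightarrow> 'a::field"
  assumes V: "is_subring V" "\<And>y. y \<in> V \<or> inverse y \<in> V"
    and \<Phi>: "\<And>u v. \<Phi> (u + v) = \<Phi> u + \<Phi> v" "\<And>c. \<exists>k\<in>V. \<forall>v. \<Phi> (c *\<^sub>R v) = k * \<Phi> v"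
    and st: "stable_span x l r"
    and der: "\<And>s. s \<in> {l<..<r} \<Longrightarrow> (x has_vector_derivative x' s) (at s)"
    and nz: "\<And>s. s \<in> {l<..<r} \<Longrightarrow> \<Phi> (x s) \<noteq> 0"
  obtains l' r' where "l \<le> l'" "r' \<le> r" "stable_span x l' r'"
    "\<And>s. s \<in> {l'<..<r'} \<Longrightarrow> \<Phi> (x' s) / \<Phi> (x s) \<in> V"
proof -
  note D = is_subringD[OF V(1)]
  have \<Phi>0: "\<Phi> 0 = 0" using \<Phi>(1)[of 0 0] by (metis add.right_neutral add_left_cancel)
  \<comment> \<open>Applied to \<open>V\<close> itself, for valuation at least that of
    \<open>y\<close>, and to the maximal ideal of \<open>V\<close>, for strictly larger
    valuation.\<close>
  have sub: "subspace {v. \<exists>z\<in>N. \<Phi> v = y * z}"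
    if "0 \<in> N" "\<And>a b. a \<in> N \<Longrightarrow> b \<in> N \<Longrightarrow> a + b \<in> N" "\<And>k a. k \<in> V \<Longrightarrow> a \<in> N \<Longrightarrow> k * a \<in> N" for N y
    unfolding subspace_def
  proof (intro conjI ballI allI)
    show "0 \<in> {v. \<exists>z\<in>N. \<Phi> v = y * z}" using that(1) \<Phi>0 by force
    fix u assume "u \<in> {v. \<exists>z\<in>N. \<Phi> v = y * z}"
    then obtain z where z: "z \<in> N" "\<Phi> u = y * z" by blast
    show "c *\<^sub>R u \<in> {v. \<exists>z\<in>N. \<Phi> v = y * z}" for c
    proof -
      obtain k where "k \<in> V" "\<Phi> (c *\<^sub>R u) = k * \<Phi> u" using \<Phi>(2) by blast
      then have "\<Phi> (c *\<^sub>R u) = y * (k * z)" by (simp add: z)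
      then show ?thesis using that(3)[OF \<open>k \<in> V\<close> z(1)] by blast
    qed
    fix v assume "v \<in> {v. \<exists>z\<in>N. \<Phi> v = y * z}"
    then obtain z' where z': "z' \<in> N" "\<Phi> v = y * z'" by blast
    show "u + v \<in> {v. \<exists>z\<in>N. \<Phi> v = y * z}"
      using that(2)[OF z(1) z'(1)] by (auto simp: z z' \<Phi>(1) distrib_left intro!: bexI[of _ "z + z'"])
  qed
  define H where "H s = {v. \<exists>z\<in>V. \<Phi> v = \<Phi> (x s) * z}" for s
  have subH: "subspace (H s)" for s unfolding H_def by (rule sub) (fact D)+
  have lr: "l < r" using st by (simp add: stable_span_def)
  \<comment> \<open>The subspaces \<open>H s\<close> form a chain, since of two field elements one
    divides the other in \<open>V\<close>. The largest dimension therefore selects the smallest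
    valuation.\<close>
  obtain s1 where s1: "s1 \<in> {l<..<r}" "\<And>s. s \<in> {l<..<r} \<Longrightarrow> dim (H s) \<le> dim (H s1)"
  proof -
    have "\<exists>s1. s1 \<in> {l<..<r} \<and> (\<forall>s. s \<in> {l<..<r} \<longrightarrow> dim (H s) \<le> dim (H s1))"
      by (rule ex_has_greatest_nat[of _ "(l + r) / 2" _ "DIM('v) + 1"])
        (use lr dim_subset_UNIV in \<open>auto simp: less_Suc_eq_le\<close>)
    then show thesis using that by blast
  qed
  have in_H: "x s \<in> H s1" if s: "s \<in> {l<..<r}" for s
  proof (cases "\<Phi> (x s) / \<Phi> (x s1) \<in> V")
    case True
    then show ?thesis using nz[OF s1(1)] by (auto simp: H_def intro!: bexI[of _ "\<Phi> (x s) / \<Phi> (x s1)"])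
  next
    case False
    then have z: "\<Phi> (x s1) / \<Phi> (x s) \<in> V" using V(2)[of "\<Phi> (x s) / \<Phi> (x s1)"] by simp
    have le: "H s1 \<subseteq> H s"
    proof
      fix v assume "v \<in> H s1"
      then obtain y where y: "y \<in> V" "\<Phi> v = \<Phi> (x s1) * y" by (auto simp: H_def)
      then have "\<Phi> v = \<Phi> (x s) * (\<Phi> (x s1) / \<Phi> (x s) * y)" using nz[OF s] by simp
      then show "v \<in> H s" using D(4)[OF z y(1)] unfolding H_def by blast
    qed
    have "H s1 = H s" by (rule subspace_dim_equal[OF subH subH le]) (use s1 s in auto)
    moreover have "x s \<in> H s" unfolding H_def using D(1) by force
    ultimately show ?thesis by simp
  qed
  \<comment> \<open>The maximal ideal of \<open>V\<close>, that is, its nonunits. Zero is listed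
    separately because \<open>inverse 0 = 0\<close> lies in \<open>V\<close>.\<close>
  define N where "N = {z \<in> V. z = 0 \<or> inverse z \<notin> V}"
  have N_mult: "k * a \<in> N" if ka: "k \<in> V" "a \<in> N" for k a
  proof -
    have "k * a \<in> V" using ka by (auto simp: N_def intro: D(4))
    moreover have "k * a = 0 \<or> inverse (k * a) \<notin> V"
    proof (rule disjCI)
      assume "\<not> inverse (k * a) \<notin> V"
      then have "k * inverse (k * a) \<in> V" using ka D(4) by blast
      then have "k = 0 \<or> inverse a \<in> V" by (cases "k = 0") (auto simp: mult.assoc[symmetric])
      then show "k * a = 0" using ka by (auto simp: N_def)
    qed
    ultimately show ?thesis by (simp add: N_def)
  qed
  have N_add': "a + b \<in> N" if ab: "a \<in> N" "b \<in> N" and q: "a / b \<in> V" "b \<noteq> 0" for a b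
  proof -
    have "(a / b + 1) * b \<in> N" by (intro N_mult D q ab)
    then show ?thesis using q by (simp add: distrib_right)
  qed
  have N_add: "a + b \<in> N" if ab: "a \<in> N" "b \<in> N" for a b
  proof -
    consider "a = 0" | "b = 0" | "b \<noteq> 0" "a / b \<in> V" | "a \<noteq> 0" "b / a \<in> V"
      using V(2)[of "a / b"] by auto
    then show ?thesis
      using ab N_add'[of a b] N_add'[of b a] by cases (auto simp: add.commute)
  qed
  \<comment> \<open>Vectors of valuation strictly above the minimum. Where the curve avoids
    \<open>H'\<close>, the quotient of \<open>\<Phi> (x s)\<close> by \<open>\<Phi> (x s1)\<close>
    is a unit of \<open>V\<close>.\<close>
  define H' where "H' = {v. \<exists>z\<in>N. \<Phi> v = \<Phi> (x s1) * z}"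
  have subH': "subspace H'"
    unfolding H'_def
  proof (rule sub)
    show "0 \<in> N" using D(2) by (simp add: N_def)
  qed (fact N_mult N_add)+
  have "x s1 \<notin> H'"
  proof
    assume "x s1 \<in> H'"
    then obtain z where "z \<in> N" "\<Phi> (x s1) = \<Phi> (x s1) * z" by (auto simp: H'_def)
    then have "1 \<in> N" using nz[OF s1(1)] by simp
    then show False using D(1) by (simp add: N_def)
  qed
  then have out: "\<not> x ` {l<..<r} \<subseteq> H'" using s1 by blast
  have cont: "continuous_on {l<..<r} x"
    using der by (intro continuous_at_imp_continuous_on) (blast intro: has_vector_derivative_continuous)
  obtain l' r' where sub': "l \<le> l'" "r' \<le> r" "stable_span x l' r'"
    and avoid: "\<And>s. s \<in> {l'<..<r'} \<Longrightarrow> x s \<notin> H'"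
    using stable_span_avoid[OF st cont subH' out order_refl order_refl st] by blast
  show thesis
  proof (rule that[OF sub'])
    fix s assume s: "s \<in> {l'<..<r'}"
    then have s': "s \<in> {l<..<r}" using sub' by auto
    obtain z where z: "z \<in> V" "\<Phi> (x s) = \<Phi> (x s1) * z" using in_H[OF s'] by (auto simp: H_def)
    have "z \<notin> N" using avoid[OF s] z by (auto simp: H'_def)
    then have u: "z \<noteq> 0" "inverse z \<in> V" using z by (auto simp: N_def)
    \<comment> \<open>The whole curve lies in \<open>H s1\<close>, so its derivative does too: the
      minimal valuation also bounds \<open>\<Phi> (x' s)\<close> from below.\<close>
    have "x' s \<in> H s1" by (rule vector_derivative_in_subspace[OF der[OF s'] subH s' in_H])
    then obtain y where y: "y \<in> V" "\<Phi> (x' s) = \<Phi> (x s1) * y" by (auto simp: H_def)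
    have "\<Phi> (x' s) / \<Phi> (x s) = y * inverse z"
      using nz[OF s1(1)] u by (simp add: y z field_simps)
    then show "\<Phi> (x' s) / \<Phi> (x s) \<in> V" using D(4)[OF y(1) u(2)] by simp
  qed
qed

text \<open>If \<open>w = (\<lambda>t. x s \<bullet> pw t)\<close> took infinitely many values, it would have a pole at some
  valuation of the ultrapower field along a sequence of parameters with distinct values of \<open>w\<close>,
  whereas the right-hand side divided by \<open>a b\<close> is generically integral.\<close>

lemma log_derivative_product_finite_range:
  fixes x :: "real \<Rightarrow> 'v::euclidean_space" and pa pb pw :: "'t \<Rightarrow> 'v"
  assumes lr: "l < r"
    and der: "\<And>s. s \<in> {l<..<r} \<Longrightarrow> (x has_vector_derivative x' s) (at s)"
    and nz: "\<And>s t. s \<in> {l<..<r} \<Longrightarrow> t \<in> J \<Longrightarrow> x s \<bullet> pa t \<noteq> 0 \<and> x s \<bullet> pb t \<noteq> 0"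
    and eq: "\<And>s t. s \<in> {l<..<r} \<Longrightarrow> t \<in> J \<Longrightarrow>
      (x s \<bullet> pw t) * (x s \<bullet> pa t) * (x s \<bullet> pb t) = k * (x' s \<bullet> pa t) * (x' s \<bullet> pb t)"
  shows "\<exists>s\<in>{l<..<r}. finite ((\<lambda>t. x s \<bullet> pw t) ` J)"
proof (rule ccontr)
  assume inf: "\<not> ?thesis"
  obtain l0 r0 where lr0: "l \<le> l0" "r0 \<le> r" and st0: "stable_span x l0 r0"
    using stable_span_exists[OF lr] by blast
  have sub0: "s \<in> {l<..<r}" if "s \<in> {l0<..<r0}" for s using that lr0 by auto
  define s0 where "s0 = (l0 + r0) / 2"
  have s0: "s0 \<in> {l0<..<r0}" using st0 by (auto simp: stable_span_def s0_def)
  have "infinite ((\<lambda>t. x s0 \<bullet> pw t) ` J)" using inf sub0[OF s0] by blast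
  then obtain w :: "nat \<Rightarrow> real" where w: "inj w" "range w \<subseteq> (\<lambda>t. x s0 \<bullet> pw t) ` J"
    using infinite_countable_subset by blast
  then have "\<forall>n. \<exists>t\<in>J. w n = x s0 \<bullet> pw t" by blast
  then obtain t where t: "\<And>n. t n \<in> J" "\<And>n. w n = x s0 \<bullet> pw (t n)" by metis
  define \<Phi> where "\<Phi> p v = hyper (\<lambda>n. v \<bullet> p (t n))" for p :: "'t \<Rightarrow> 'v" and v
  \<comment> \<open>The ring of real polynomials in the inverse of \<open>w\<close>. A valuation
    ring above it that omits \<open>w\<close> is trivial on the constants and gives \<open>w\<close>
    a pole.\<close>
  define R0 where "R0 = range (\<lambda>p :: real poly. hyper (\<lambda>n. poly p (inverse (w n))))"
  have "is_subring R0"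
    unfolding is_subring_def
  proof (intro conjI ballI)
    show "1 \<in> R0" unfolding R0_def by (rule range_eqI[of _ _ 1]) (simp add: hyper_arith)
    fix a b assume "a \<in> R0" "b \<in> R0"
    then obtain p q where pq: "a = hyper (\<lambda>n. poly p (inverse (w n)))"
      "b = hyper (\<lambda>n. poly q (inverse (w n)))" by (auto simp: R0_def)
    show "a - b \<in> R0" unfolding R0_def by (rule range_eqI[of _ _ "p - q"]) (simp add: pq hyper_arith)
    show "a * b \<in> R0" unfolding R0_def by (rule range_eqI[of _ _ "p * q"]) (simp add: pq hyper_arith)
  qed
  moreover have "inverse (hyper w) \<in> R0"
    unfolding R0_def by (rule range_eqI[of _ _ "[:0, 1:]"]) (simp add: hyper_arith)
  moreover have "hyper w \<notin> R0"
  proof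
    assume "hyper w \<in> R0"
    then obtain p :: "real poly" where "hyper w = hyper (\<lambda>n. poly p (inverse (w n)))"
      by (auto simp: R0_def)
    then have p: "\<forall>\<^sub>F n in free_ultra. w n = poly p (inverse (w n))" by (simp add: hyper_eq_iff)
    \<comment> \<open>From \<open>w = p (1 / w)\<close>, the number \<open>1 / w\<close> is a root
      of \<open>X * p - 1\<close>, a nonzero polynomial since its value at 0 is -1. So only finitely
      many terms of the injective sequence can satisfy the equation. A term equal to 0 is allowed
      for separately, its inverse being 0 by convention.\<close>
    define q where "q = pCons 0 p - 1"
    have "poly q 0 \<noteq> 0" by (simp add: q_def)
    then have "q \<noteq> 0" by auto
    then have fin: "finite (insert 0 (inverse ` {u. poly q u = 0}))"
      by (intro finite.insertI finite_imageI poly_roots_finite)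
    have "w n \<in> insert 0 (inverse ` {u. poly q u = 0})" if "w n = poly p (inverse (w n))" for n
    proof (cases "w n = 0")
      case False
      have "poly q (inverse (w n)) = inverse (w n) * poly p (inverse (w n)) - 1" by (simp add: q_def)
      also have "\<dots> = inverse (w n) * w n - 1" by (simp only: that[symmetric])
      also have "\<dots> = 0" using False by simp
      finally show ?thesis by (auto intro!: image_eqI[of _ _ "inverse (w n)"])
    qed simp
    then have "{n. w n = poly p (inverse (w n))} \<subseteq> w -` insert 0 (inverse ` {u. poly q u = 0})"
      by blast
    then have "finite {n. w n = poly p (inverse (w n))}"
      using finite_vimageI[OF fin w(1)] finite_subset by blast
    then have "\<forall>\<^sub>F n in cofinite. w n \<noteq> poly p (inverse (w n))" by (simp add: eventually_cofinite)
    then have "\<forall>\<^sub>F n in free_ultra. w n \<noteq> poly p (inverse (w n))"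
      using free_ultra(2) by (simp add: le_filter_def)
    then have "\<forall>\<^sub>F n in free_ultra. False" using p by eventually_elim simp
    then show False using free_ultra(1) by simp
  qed
  ultimately obtain V where V: "is_subring V" "R0 \<subseteq> V" "hyper w \<notin> V" "\<And>y. y \<in> V \<or> inverse y \<in> V"
    using exists_valuation_ring by metis
  have const: "hyper (\<lambda>n. c) \<in> V" for c
    using V(2) unfolding R0_def by (rule subsetD) (rule range_eqI[of _ _ "[:c:]"], simp)
  have \<Phi>_add: "\<Phi> p (u + v) = \<Phi> p u + \<Phi> p v" for p u v
    by (simp add: \<Phi>_def hyper_arith inner_add_left)
  have \<Phi>_scale: "\<Phi> p (c *\<^sub>R v) = hyper (\<lambda>n. c) * \<Phi> p v" for p c v
    by (simp add: \<Phi>_def hyper_arith)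
  have \<Phi>_scale': "\<exists>k\<in>V. \<forall>v. \<Phi> p (c *\<^sub>R v) = k * \<Phi> p v" for p c
    using const \<Phi>_scale by blast
  have \<Phi>nz: "\<Phi> pa (x s) \<noteq> 0" "\<Phi> pb (x s) \<noteq> 0" if "s \<in> {l<..<r}" for s
    using nz[OF that t(1)] by (auto simp: \<Phi>_def hyper_arith intro!: hyper_neI)
  obtain l1 r1 where 1: "l0 \<le> l1" "r1 \<le> r0" "stable_span x l1 r1"
    "\<And>s. s \<in> {l1<..<r1} \<Longrightarrow> \<Phi> pa (x' s) / \<Phi> pa (x s) \<in> V"
    by (rule generic_log_derivative_integral[where \<Phi> = "\<Phi> pa", OF V(1,4) \<Phi>_add \<Phi>_scale' st0])
      (use der \<Phi>nz sub0 in blast)+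
  have sub1: "s \<in> {l0<..<r0}" if "s \<in> {l1<..<r1}" for s using that 1 by auto
  obtain l2 r2 where 2: "l1 \<le> l2" "r2 \<le> r1" "stable_span x l2 r2"
    "\<And>s. s \<in> {l2<..<r2} \<Longrightarrow> \<Phi> pb (x' s) / \<Phi> pb (x s) \<in> V"
    by (rule generic_log_derivative_integral[where \<Phi> = "\<Phi> pb", OF V(1,4) \<Phi>_add \<Phi>_scale' 1(3)])
      (use der \<Phi>nz sub0 sub1 in blast)+
  \<comment> \<open>The vectors for which \<open>pw\<close> gives no pole. The curve is outside
    \<open>H\<close> at \<open>s0\<close>; by stability of the span it is outside on a subinterval
    of the generic parameters, where the equation makes W integral.\<close>
  define H where "H = {v. \<Phi> pw v \<in> V}"
  have "subspace H"
    unfolding subspace_def H_def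
  proof (intro conjI ballI allI CollectI)
    show "\<Phi> pw 0 \<in> V" using const[of 0] by (simp add: \<Phi>_def)
    show "\<Phi> pw (u + v) \<in> V" if "u \<in> {v. \<Phi> pw v \<in> V}" "v \<in> {v. \<Phi> pw v \<in> V}" for u v
      using that is_subringD(6)[OF V(1)] by (simp add: \<Phi>_add)
    show "\<Phi> pw (c *\<^sub>R u) \<in> V" if "u \<in> {v. \<Phi> pw v \<in> V}" for c u
      using that const is_subringD(4)[OF V(1)] by (simp add: \<Phi>_scale)
  qed
  moreover have "x s0 \<notin> H" using V(3) by (simp add: H_def \<Phi>_def flip: t(2))
  then have "\<not> x ` {l0<..<r0} \<subseteq> H" using s0 by blast
  moreover have "continuous_on {l2<..<r2} x"
  proof (intro continuous_at_imp_continuous_on ballI)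
    fix s assume "s \<in> {l2<..<r2}"
    then have "s \<in> {l<..<r}" using 2(1,2) sub0 sub1 by auto
    then show "isCont x s" using der has_vector_derivative_continuous by blast
  qed
  ultimately obtain l3 r3 where 3: "l2 \<le> l3" "r3 \<le> r2" "stable_span x l3 r3"
    "\<And>s. s \<in> {l3<..<r3} \<Longrightarrow> x s \<notin> H"
    using stable_span_avoid[OF 2(3) _ _ _ order_trans[OF 1(1) 2(1)] order_trans[OF 2(2) 1(2)] st0, of H]
    by blast
  define s where "s = (l3 + r3) / 2"
  have s3: "s \<in> {l3<..<r3}" using 3(3) by (auto simp: stable_span_def s_def)
  then have s2: "s \<in> {l2<..<r2}" using 3(1,2) by auto
  then have s1: "s \<in> {l1<..<r1}" using 2(1,2) by auto
  then have sI: "s \<in> {l<..<r}" using sub0 sub1 by blast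
  have "\<Phi> pw (x s) * \<Phi> pa (x s) * \<Phi> pb (x s) = hyper (\<lambda>n. k) * \<Phi> pa (x' s) * \<Phi> pb (x' s)"
    using eq[OF sI t(1)] by (simp add: \<Phi>_def hyper_arith)
  then have "\<Phi> pw (x s) = hyper (\<lambda>n. k) * (\<Phi> pa (x' s) / \<Phi> pa (x s)) * (\<Phi> pb (x' s) / \<Phi> pb (x s))"
    using \<Phi>nz[OF sI] by (simp add: field_simps)
  also have "\<dots> \<in> V"
    by (intro is_subringD(4)[OF V(1)] const 1(4) 2(4) s1 s2)
  finally show False using 3(4)[OF s3] by (simp add: H_def)
qed

section \<open>The sine-Gordon equation for separable functions\<close>

lemma has_real_derivative_inner_left:
  "(x has_vector_derivative x') F \<Longrightarrow> ((\<lambda>s. x s \<bullet> v) has_real_derivative x' \<bullet> v) F"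
  unfolding has_real_derivative_iff_has_vector_derivative
  by (rule bounded_linear.has_vector_derivative[OF bounded_linear_inner_left])

lemma has_real_derivative_inner_right:
  "(x has_vector_derivative x') F \<Longrightarrow> ((\<lambda>s. v \<bullet> x s) has_real_derivative v \<bullet> x') F"
  unfolding has_real_derivative_iff_has_vector_derivative
  by (rule bounded_linear.has_vector_derivative[OF bounded_linear_inner_right])

lemma DERIV_eq_0_of_eq_const:
  fixes h :: "real \<Rightarrow> real"
  assumes "(h has_real_derivative d) (at t)" "t \<in> {a<..<b}" "\<And>u. u \<in> {a<..<b} \<Longrightarrow> h u = c"
  shows "d = 0"
proof -
  have "(h has_real_derivative 0) (at t)"
    by (rule has_field_derivative_transform_within_open[where f = "\<lambda>u. c" and S = "{a<..<b}"])
      (use assms in auto)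
  then show ?thesis using assms(1) DERIV_unique by blast
qed

text \<open>With \<open>\<alpha> s \<bullet> \<beta> t = cos \<omega>\<close>, the assumption \<open>eq\<close> is the sine-Gordon equation
  \<open>\<omega>\<^sub>s\<^sub>t = - K e \<gamma> sin \<omega>\<close>, and \<open>W\<close> in the proof is \<open>\<omega>\<^sub>s\<^sup>2\<close>.\<close>

lemma separable_sine_Gordon_zero:
  fixes \<alpha> \<alpha>' \<alpha>'' \<beta> \<beta>' :: "real \<Rightarrow> 'v::euclidean_space" and e e' \<gamma> :: "real \<Rightarrow> real"
  assumes lr: "l < r" and pq: "p < q"
    and \<alpha>: "\<And>s. s \<in> {l<..<r} \<Longrightarrow> (\<alpha> has_vector_derivative \<alpha>' s) (at s)"
    and \<alpha>': "\<And>s. s \<in> {l<..<r} \<Longrightarrow> (\<alpha>' has_vector_derivative \<alpha>'' s) (at s)"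
    and e: "\<And>s. s \<in> {l<..<r} \<Longrightarrow> (e has_real_derivative e' s) (at s)"
    and \<beta>: "\<And>t. t \<in> {p<..<q} \<Longrightarrow> (\<beta> has_vector_derivative \<beta>' t) (at t)"
    and \<gamma>: "continuous_on {p<..<q} \<gamma>"
    and e_nz: "\<And>s. s \<in> {l<..<r} \<Longrightarrow> e s \<noteq> 0" and \<gamma>_nz: "\<And>t. t \<in> {p<..<q} \<Longrightarrow> \<gamma> t \<noteq> 0"
    and f: "\<And>s t. s \<in> {l<..<r} \<Longrightarrow> t \<in> {p<..<q} \<Longrightarrow> (\<alpha> s \<bullet> \<beta> t)\<^sup>2 < 1"
    and eq: "\<And>s t. s \<in> {l<..<r} \<Longrightarrow> t \<in> {p<..<q} \<Longrightarrow>
      \<alpha>' s \<bullet> \<beta>' t + (\<alpha> s \<bullet> \<beta> t) * (\<alpha>' s \<bullet> \<beta> t) * (\<alpha> s \<bullet> \<beta>' t) / (1 - (\<alpha> s \<bullet> \<beta> t)\<^sup>2) =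
      K * e s * \<gamma> t * (1 - (\<alpha> s \<bullet> \<beta> t)\<^sup>2)"
  shows "K = 0"
proof (rule ccontr)
  assume K: "K \<noteq> 0"
  \<comment> \<open>The middle third is a compact subinterval, on which the continuous function
    \<open>\<gamma> t *\<^sub>R \<beta> t\<close> has an antiderivative.\<close>
  define a b where "a = (2 * p + q) / 3" and "b = (p + 2 * q) / 3"
  have ab: "p < a" "a < b" "b < q" using pq by (auto simp: a_def b_def)
  then have J: "{a..b} \<subseteq> {p<..<q}" by auto
  have cont\<beta>: "continuous_on {p<..<q} \<beta>"
    using \<beta> by (intro continuous_at_imp_continuous_on) (blast intro: has_vector_derivative_continuous)
  have "continuous_on {a..b} (\<lambda>t. \<gamma> t *\<^sub>R \<beta> t)"
    by (intro continuous_intros continuous_on_subset[OF \<gamma> J] continuous_on_subset[OF cont\<beta> J])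
  then obtain B where B: "\<And>t. t \<in> {a..b} \<Longrightarrow> (B has_vector_derivative \<gamma> t *\<^sub>R \<beta> t) (at t within {a..b})"
    using antiderivative_continuous by metis
  define D where "D s t = 1 - (\<alpha> s \<bullet> \<beta> t)\<^sup>2" for s t
  define W where "W s t = (\<alpha>' s \<bullet> \<beta> t)\<^sup>2 / D s t" for s t
  have D: "D s t > 0" if "s \<in> {l<..<r}" "t \<in> {p<..<q}" for s t
    using f[OF that] by (simp add: D_def)
  have W_t: "(W s has_real_derivative 2 * K * e s * \<gamma> t * (\<alpha>' s \<bullet> \<beta> t)) (at t)"
    if st: "s \<in> {l<..<r}" "t \<in> {p<..<q}" for s t
  proof -
    define N N' f g where "N = \<alpha>' s \<bullet> \<beta> t" and "N' = \<alpha>' s \<bullet> \<beta>' t"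
      and "f = \<alpha> s \<bullet> \<beta> t" and "g = \<alpha> s \<bullet> \<beta>' t"
    note d = has_real_derivative_inner_right[OF \<beta>[OF st(2)]]
    have "(W s has_real_derivative (2 * N * N' * D s t - N\<^sup>2 * (- (2 * f * g))) / (D s t)\<^sup>2) (at t)"
      unfolding W_def D_def N_def N'_def f_def g_def
      using D[OF st] by (auto intro!: derivative_eq_intros d simp: D_def power2_eq_square)
    moreover have "(2 * N * N' * D s t - N\<^sup>2 * (- (2 * f * g))) / (D s t)\<^sup>2 =
        2 * N / D s t * (N' + f * N * g / D s t)"
      using D[OF st] by (simp add: field_simps power2_eq_square)
    moreover have "N' + f * N * g / D s t = K * e s * \<gamma> t * D s t"
      using eq[OF st] by (simp add: N_def N'_def f_def g_def D_def)
    moreover have "2 * N / D s t * (K * e s * \<gamma> t * D s t) = 2 * K * e s * \<gamma> t * N"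
      using D[OF st] by simp
    ultimately show ?thesis by (simp add: N_def)
  qed
  \<comment> \<open>The conservation law integrated in \<open>t\<close>. The integral acts on
    \<open>\<beta>\<close> alone and leaves a sum of products of functions of \<open>s\<close> and
    of \<open>t\<close>.\<close>
  have W_eq: "W s t = W s a + 2 * K * e s * (\<alpha>' s \<bullet> (B t - B a))"
    if s: "s \<in> {l<..<r}" and t: "t \<in> {a..b}" for s t
  proof -
    let ?h = "\<lambda>t. W s t - 2 * K * e s * (\<alpha>' s \<bullet> B t)"
    have "(?h has_real_derivative 0) (at u within {a..b})" if u: "u \<in> {a..b}" for u
      using DERIV_subset[OF W_t[OF s, of u], of "{a..b}"] has_real_derivative_inner_right[OF B[OF u]] u J
      by (auto intro!: derivative_eq_intros)
    then obtain c where "\<And>u. u \<in> {a..b} \<Longrightarrow> ?h u = c"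
      using has_field_derivative_zero_constant[of "{a..b}" ?h] by auto
    then have "?h t = ?h a" using t ab by simp
    then show ?thesis by (simp add: inner_diff_right algebra_simps)
  qed
  define c' where "c' s = (2 * (\<alpha>' s \<bullet> \<beta> a) * (\<alpha>'' s \<bullet> \<beta> a) * D s a +
      (\<alpha>' s \<bullet> \<beta> a)\<^sup>2 * (2 * (\<alpha> s \<bullet> \<beta> a) * (\<alpha>' s \<bullet> \<beta> a))) / (D s a)\<^sup>2" for s
  \<comment> \<open>One vector collects all functions of \<open>s\<close>, so that
    \<open>(1 - f) / 2\<close>, \<open>(1 + f) / 2\<close> and W become its inner products with
    vectors depending on \<open>t\<close> only, where
    \<open>f = \<alpha> s \<bullet> \<beta> t\<close>. The three families must share one curve
    because the generic parameters are chosen for it.\<close>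
  define x where "x s = (1 :: real, \<alpha> s, W s a, (2 * K * e s) *\<^sub>R \<alpha>' s)" for s
  define x' where "x' s = (0 :: real, \<alpha>' s, c' s, (2 * K * e s) *\<^sub>R \<alpha>'' s + (2 * K * e' s) *\<^sub>R \<alpha>' s)" for s
  define pa where "pa t = (1 / 2 :: real, (- 1 / 2) *\<^sub>R \<beta> t, 0 :: real, 0 :: 'v)" for t
  define pb where "pb t = (1 / 2 :: real, (1 / 2) *\<^sub>R \<beta> t, 0 :: real, 0 :: 'v)" for t
  define pw where "pw t = (0 :: real, 0 :: 'v, 1 :: real, B t - B a)" for t
  have pw: "x s \<bullet> pw t = W s t" if "s \<in> {l<..<r}" "t \<in> {a..b}" for s t
    using W_eq[OF that] by (simp add: x_def pw_def inner_Pair)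
  have "\<exists>s\<in>{l<..<r}. finite ((\<lambda>t. x s \<bullet> pw t) ` {a..b})"
  proof (rule log_derivative_product_finite_range[OF lr, where k = "-1" and pa = pa and pb = pb and x' = x'])
    fix s assume s: "s \<in> {l<..<r}"
    have a: "a \<in> {p<..<q}" using ab by auto
    have "((\<lambda>s. W s a) has_real_derivative c' s) (at s)"
      unfolding W_def c'_def D_def
      using D[OF s a] by (auto intro!: derivative_eq_intros has_real_derivative_inner_left[OF \<alpha>[OF s]]
          has_real_derivative_inner_left[OF \<alpha>'[OF s]] simp: D_def power2_eq_square)
    then show "(x has_vector_derivative x' s) (at s)"
      unfolding x_def x'_def has_real_derivative_iff_has_vector_derivative
      using \<alpha>[OF s] \<alpha>'[OF s] e[OF s]
      by (auto intro!: derivative_eq_intros has_vector_derivative_Pair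
          simp: has_real_derivative_iff_has_vector_derivative)
  next
    fix s t assume s: "s \<in> {l<..<r}" and t: "t \<in> {a..b}"
    have t': "t \<in> {p<..<q}" using t J by auto
    have v: "x s \<bullet> pa t = (1 - \<alpha> s \<bullet> \<beta> t) / 2" "x s \<bullet> pb t = (1 + \<alpha> s \<bullet> \<beta> t) / 2"
      "x' s \<bullet> pa t = - (\<alpha>' s \<bullet> \<beta> t) / 2" "x' s \<bullet> pb t = (\<alpha>' s \<bullet> \<beta> t) / 2"
      by (simp_all add: x_def x'_def pa_def pb_def inner_Pair field_simps)
    show "x s \<bullet> pa t \<noteq> 0 \<and> x s \<bullet> pb t \<noteq> 0"
      using f[OF s t'] unfolding v by (auto simp: abs_square_less_1)
    have "W s t * D s t = (\<alpha>' s \<bullet> \<beta> t)\<^sup>2" using D[OF s t'] by (simp add: W_def)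
    then show "(x s \<bullet> pw t) * (x s \<bullet> pa t) * (x s \<bullet> pb t) = - 1 * (x' s \<bullet> pa t) * (x' s \<bullet> pb t)"
      unfolding pw[OF s t] v by (simp add: D_def power2_eq_square field_simps)
  qed
  then obtain s where s: "s \<in> {l<..<r}" and fin: "finite (W s ` {a..b})"
    using pw by (metis (no_types, lifting) image_cong)
  have "continuous_on {a..b} (W s)"
    using W_t[OF s] J by (intro continuous_at_imp_continuous_on ballI DERIV_isCont) blast
  then have "W s constant_on {a..b}" using fin by (intro continuous_finite_range_constant) auto
  then obtain c where c: "\<And>t. t \<in> {a..b} \<Longrightarrow> W s t = c" by (auto simp: constant_on_def)
  \<comment> \<open>Constancy of W annihilates its \<open>t\<close>-derivative, a nonzero multiple
    of this product. Vanishing on an interval then gives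
    \<open>\<alpha>' s \<bullet> \<beta>' m = 0\<close>, so the left side of \<open>eq\<close> is
    zero.\<close>
  have N0: "\<alpha>' s \<bullet> \<beta> t = 0" if t: "t \<in> {a<..<b}" for t
  proof -
    have t': "t \<in> {p<..<q}" using t ab by auto
    have "2 * K * e s * \<gamma> t * (\<alpha>' s \<bullet> \<beta> t) = 0"
      by (rule DERIV_eq_0_of_eq_const[OF W_t[OF s t'] t]) (use c in auto)
    then show ?thesis using K e_nz[OF s] \<gamma>_nz[OF t'] by simp
  qed
  define m where "m = (a + b) / 2"
  have m: "m \<in> {a<..<b}" "m \<in> {p<..<q}" using ab by (auto simp: m_def)
  have "\<alpha>' s \<bullet> \<beta>' m = 0"
    by (rule DERIV_eq_0_of_eq_const[OF has_real_derivative_inner_right[OF \<beta>[OF m(2)]] m(1) N0])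
  then have "K * e s * \<gamma> m * D s m = 0" using eq[OF s m(2)] N0[OF m(1)] by (simp add: D_def)
  then show False using K e_nz[OF s] \<gamma>_nz[OF m(2)] D[OF s m(2)] by simp
qed

section \<open>Calculus of \<open>C\<^sup>k\<close> maps\<close>

lemma C_k_on_cong:
  assumes "open S" "\<And>x. x \<in> S \<Longrightarrow> f x = g x"
  shows "C_k_on k f S \<longleftrightarrow> C_k_on k g S"
proof -
  have imp: "C_k_on k g S" if "C_k_on k f S" "\<And>x. x \<in> S \<Longrightarrow> f x = g x" for f g
    using that
  proof (induction k arbitrary: f g)
    case 0
    then show ?case using continuous_on_cong[of S S f g] by simp
  next
    case (Suc k)
    have g: "(g has_derivative frechet_derivative f (at x)) (at x)" if "x \<in> S" for x
    proof (rule has_derivative_transform_within_open[OF _ assms(1) that])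
      show "(f has_derivative frechet_derivative f (at x)) (at x)"
        using Suc.prems(1) that by (simp flip: frechet_derivative_works)
    qed (rule Suc.prems)
    have "C_k_on k (\<lambda>x. frechet_derivative g (at x) v) S" for v
    proof (rule Suc.IH)
      show "C_k_on k (\<lambda>x. frechet_derivative f (at x) v) S" using Suc.prems(1) by simp
      show "frechet_derivative f (at x) v = frechet_derivative g (at x) v" if "x \<in> S" for x
        by (rule fun_cong[OF frechet_derivative_at[OF g[OF that]]])
    qed
    then show ?case using g unfolding C_k_on.simps differentiable_def by blast
  qed
  show ?thesis using imp[of f g] imp[of g f] assms(2) by metis
qed

lemma C_k_on_subset: "C_k_on k f S \<Longrightarrow> T \<subseteq> S \<Longrightarrow> C_k_on k f T"
  by (induction k arbitrary: f) (auto intro: continuous_on_subset)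

lemma C_k_on_Suc_imp: "C_k_on (Suc k) f S \<Longrightarrow> C_k_on k f S"
proof (induction k arbitrary: f)
  case 0
  then show ?case
    by (auto intro!: continuous_at_imp_continuous_on differentiable_imp_continuous_within)
next
  case (Suc k)
  then show ?case by (metis C_k_on.simps(2))
qed

lemma C_k_on_SucI:
  assumes "open S" "\<And>x. x \<in> S \<Longrightarrow> (f has_derivative f' x) (at x)" "\<And>v. C_k_on k (\<lambda>x. f' x v) S"
  shows "C_k_on (Suc k) f S"
proof -
  have "frechet_derivative f (at x) v = f' x v" if "x \<in> S" for x v
    using frechet_derivative_at[OF assms(2)[OF that]] by simp
  then have "C_k_on k (\<lambda>x. frechet_derivative f (at x) v) S" for v
    using C_k_on_cong[OF assms(1), of "\<lambda>x. frechet_derivative f (at x) v" "\<lambda>x. f' x v"] assms(3) by simp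
  then show ?thesis using assms(2) by (auto simp: differentiable_def)
qed

lemma C_k_on_SucD:
  "C_k_on (Suc k) f S \<Longrightarrow> x \<in> S \<Longrightarrow> (f has_derivative frechet_derivative f (at x)) (at x)"
  by (simp flip: frechet_derivative_works)

lemma C_k_on_const: "C_k_on k (\<lambda>x. c) S"
  by (induction k arbitrary: c) (auto simp: frechet_derivative_const)

lemma C_k_on_bounded_linear:
  assumes "bounded_linear f"
  shows "C_k_on k f S"
proof (cases k)
  case (Suc n)
  have "frechet_derivative f (at x) = f" for x
    using frechet_derivative_at[OF bounded_linear_imp_has_derivative[OF assms]] by simp
  then show ?thesis using assms
    by (simp add: Suc C_k_on_const bounded_linear_imp_differentiable)
qed (simp add: assms linear_continuous_on)

lemma C_k_on_add:
  assumes "open S"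
  shows "C_k_on k f S \<Longrightarrow> C_k_on k g S \<Longrightarrow> C_k_on k (\<lambda>x. f x + g x) S"
proof (induction k arbitrary: f g)
  case (Suc k)
  have "C_k_on k (\<lambda>x. frechet_derivative f (at x) v + frechet_derivative g (at x) v) S" for v
    using Suc.prems by (intro Suc.IH) simp_all
  then show ?case
    by (rule C_k_on_SucI[OF assms,
          where f' = "\<lambda>x v. frechet_derivative f (at x) v + frechet_derivative g (at x) v", rotated])
      (intro has_derivative_add C_k_on_SucD[OF Suc.prems(1)] C_k_on_SucD[OF Suc.prems(2)])
qed (auto intro: continuous_on_add)

lemma C_k_on_sum:
  assumes "open S"
  shows "(\<And>i. i \<in> I \<Longrightarrow> C_k_on k (f i) S) \<Longrightarrow> C_k_on k (\<lambda>x. \<Sum>i\<in>I. f i x) S"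
  by (induction I rule: infinite_finite_induct) (auto intro: C_k_on_const C_k_on_add[OF assms])

lemma C_k_on_bilinear:
  assumes "open S" "bounded_bilinear p"
  shows "C_k_on k f S \<Longrightarrow> C_k_on k g S \<Longrightarrow> C_k_on k (\<lambda>x. p (f x) (g x)) S"
proof (induction k arbitrary: f g)
  case 0
  then show ?case using bounded_bilinear.continuous_on[OF assms(2)] by simp
next
  case (Suc k)
  have "C_k_on k (\<lambda>x. p (f x) (frechet_derivative g (at x) v) + p (frechet_derivative f (at x) v) (g x)) S" for v
    using Suc.prems C_k_on_Suc_imp[OF Suc.prems(1)] C_k_on_Suc_imp[OF Suc.prems(2)]
    by (intro C_k_on_add[OF assms(1)] Suc.IH) simp_all
  then show ?case
    by (rule C_k_on_SucI[OF assms(1), where f' = "\<lambda>x v. p (f x) (frechet_derivative g (at x) v) +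
          p (frechet_derivative f (at x) v) (g x)", rotated])
      (intro bounded_bilinear.FDERIV[OF assms(2)] C_k_on_SucD[OF Suc.prems(1)] C_k_on_SucD[OF Suc.prems(2)])
qed

lemma C_k_on_Pair:
  assumes "open S"
  shows "C_k_on k f S \<Longrightarrow> C_k_on k g S \<Longrightarrow> C_k_on k (\<lambda>x. (f x, g x)) S"
proof (induction k arbitrary: f g)
  case (Suc k)
  have "C_k_on k (\<lambda>x. (frechet_derivative f (at x) v, frechet_derivative g (at x) v)) S" for v
    using Suc.prems by (intro Suc.IH) simp_all
  then show ?case
    by (rule C_k_on_SucI[OF assms,
          where f' = "\<lambda>x v. (frechet_derivative f (at x) v, frechet_derivative g (at x) v)", rotated])
      (intro has_derivative_Pair C_k_on_SucD[OF Suc.prems(1)] C_k_on_SucD[OF Suc.prems(2)])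
qed (auto intro: continuous_on_Pair)

text \<open>\<open>C_k_on\<close> controls derivatives in fixed directions, while the chain rule
  applies the derivative of \<open>f\<close> in a direction that varies with \<open>x\<close>.
  Expanding this direction in the basis separates the two dependences.\<close>

lemma C_k_on_compose:
  fixes f :: "'b::euclidean_space \<Rightarrow> 'c::real_normed_vector"
  assumes "open S" "g ` S \<subseteq> T"
  shows "C_k_on k f T \<Longrightarrow> C_k_on k g S \<Longrightarrow> C_k_on k (\<lambda>x. f (g x)) S"
  using assms(2)
proof (induction k arbitrary: f)
  case 0
  then show ?case by (auto intro: continuous_on_compose2)
next
  case (Suc k)
  note f = C_k_on_SucD[OF Suc.prems(1)] and g = C_k_on_SucD[OF Suc.prems(2)]
  have expand: "frechet_derivative f (at (g x)) (frechet_derivative g (at x) v) =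
      (\<Sum>b\<in>Basis. (frechet_derivative g (at x) v \<bullet> b) *\<^sub>R frechet_derivative f (at (g x)) b)"
    if "x \<in> S" for x v
  proof -
    interpret linear "frechet_derivative f (at (g x))"
      using f[of "g x"] that assms(2) by (auto intro: has_derivative_linear)
    show ?thesis
      by (subst euclidean_representation[symmetric, of "frechet_derivative g (at x) v"]) (simp add: sum scale)
  qed
  have "C_k_on k (\<lambda>x. (frechet_derivative g (at x) v \<bullet> b) *\<^sub>R frechet_derivative f (at (g x)) b) S" for v b
  proof (rule C_k_on_bilinear[OF assms(1) bounded_bilinear_scaleR])
    show "C_k_on k (\<lambda>x. frechet_derivative g (at x) v \<bullet> b) S"
      using Suc.prems by (intro C_k_on_bilinear[OF assms(1) bounded_bilinear_inner] C_k_on_const) simp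
    show "C_k_on k (\<lambda>x. frechet_derivative f (at (g x)) b) S"
      using Suc.prems C_k_on_Suc_imp[OF Suc.prems(2)] by (intro Suc.IH) simp_all
  qed
  then have "C_k_on k (\<lambda>x. frechet_derivative f (at (g x)) (frechet_derivative g (at x) v)) S" for v
    by (subst C_k_on_cong[OF assms(1) expand]) (auto intro: C_k_on_sum[OF assms(1)])
  then show ?case
  proof (rule C_k_on_SucI[OF assms(1), rotated])
    fix x assume "x \<in> S"
    then show "((\<lambda>x. f (g x)) has_derivative
        (\<lambda>v. frechet_derivative f (at (g x)) (frechet_derivative g (at x) v))) (at x)"
      using assms(2) by (intro has_derivative_compose[OF g f]) auto
  qed
qed

lemma C_k_on_local:
  assumes "\<And>x. x \<in> S \<Longrightarrow> \<exists>N. open N \<and> x \<in> N \<and> N \<subseteq> S \<and> C_k_on k f N"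
  shows "C_k_on k f S"
  using assms
proof (induction k arbitrary: f)
  case 0
  have "isCont f x" if "x \<in> S" for x
    using 0[OF that] by (auto simp: continuous_on_eq_continuous_at)
  then show ?case by (simp add: continuous_at_imp_continuous_on)
next
  case (Suc k)
  have "f differentiable at x" if "x \<in> S" for x using Suc.prems[OF that] by auto
  moreover have "C_k_on k (\<lambda>x. frechet_derivative f (at x) v) S" for v
    by (rule Suc.IH) (metis C_k_on.simps(2) Suc.prems)
  ultimately show ?case by simp
qed

lemma C_k_on_real_derivatives:
  fixes f :: "real \<Rightarrow> 'b::real_normed_vector"
  assumes "C_k_on (Suc (Suc 0)) f S" "open S"
  obtains f' f'' where "\<And>x. x \<in> S \<Longrightarrow> (f has_vector_derivative f' x) (at x)"
    "\<And>x. x \<in> S \<Longrightarrow> (f' has_vector_derivative f'' x) (at x)"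
proof -
  define f' where "f' x = frechet_derivative f (at x) 1" for x
  define f'' where "f'' x = frechet_derivative f' (at x) 1" for x
  have vd: "(h has_vector_derivative frechet_derivative h (at x) 1) (at x)"
    if "h differentiable at x" for h :: "real \<Rightarrow> 'b" and x
    using that frechet_derivative_eq_vector_derivative[OF that] vector_derivative_works by auto
  have "f differentiable at x" "f' differentiable at x" if "x \<in> S" for x
    using assms(1) that unfolding f'_def by auto
  then show thesis using that[of f' f''] vd unfolding f''_def by (metis f'_def)
qed

section \<open>Curvature of translation metrics\<close>

lemma partial_eqI:
  assumes "open S" "x \<in> S" "\<And>y. y \<in> S \<Longrightarrow> f y = h y" "(h has_derivative D) (at x)"
  shows "partial i f x = D (axis i 1)"
proof -
  have "(f has_derivative D) (at x)"
    by (rule has_derivative_transform_within_open[OF assms(4,1,2)]) (simp add: assms(3))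
  then show ?thesis unfolding partial_def using frechet_derivative_at by metis
qed

lemma matrix_inv_2x2:
  fixes M :: "real ^ 2 ^ 2"
  assumes "det M \<noteq> 0"
  shows "matrix_inv M $ 1 $ 1 = M $ 2 $ 2 / det M" "matrix_inv M $ 1 $ 2 = - M $ 1 $ 2 / det M"
    "matrix_inv M $ 2 $ 1 = - M $ 2 $ 1 / det M" "matrix_inv M $ 2 $ 2 = M $ 1 $ 1 / det M"
proof -
  define d where "d = det M"
  define N :: "real ^ 2 ^ 2" where
    "N = vector [vector [M $ 2 $ 2 / d, - M $ 1 $ 2 / d], vector [- M $ 2 $ 1 / d, M $ 1 $ 1 / d]]"
  have "M $ 1 $ 1 * M $ 2 $ 2 / d - M $ 1 $ 2 * M $ 2 $ 1 / d = 1"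
    using assms by (simp add: d_def det_2 flip: diff_divide_distrib)
  then have "M ** N = mat 1"
    by (simp add: vec_eq_iff forall_2 matrix_matrix_mult_def sum_2 N_def mat_def mult.commute)
  then have N: "M ** N = mat 1" "N ** M = mat 1" by (simp_all add: matrix_left_right_inverse)
  then have "\<exists>N. M ** N = mat 1 \<and> N ** M = mat 1" by blast
  then have "M ** matrix_inv M = mat 1" unfolding matrix_inv_def by (rule someI2_ex) simp
  then have "matrix_inv M = N"
    by (metis N(2) matrix_mul_assoc matrix_mul_lid matrix_mul_rid)
  then show "matrix_inv M $ 1 $ 1 = M $ 2 $ 2 / det M" "matrix_inv M $ 1 $ 2 = - M $ 1 $ 2 / det M"
    "matrix_inv M $ 2 $ 1 = - M $ 2 $ 1 / det M" "matrix_inv M $ 2 $ 2 = M $ 1 $ 1 / det M"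
    by (simp_all add: N_def d_def)
qed

text \<open>Since \<open>E\<close> does not depend on the second coordinate and \<open>G\<close> not on the first one, the
  mixed Christoffel symbols vanish.\<close>

lemma gaussian_curvature_translation_metric:
  fixes h :: "('a, real ^ 2) metric_field" and c :: "('a, real ^ 2) chart"
    and F F1 F2 F12 F22 :: "real ^ 2 \<Rightarrow> real" and E E' G G' G'' :: "real \<Rightarrow> real"
  assumes S: "open S"
    and M: "\<And>x. x \<in> S \<Longrightarrow> metric_matrix h c x $ 1 $ 1 = E (x $ 1)"
      "\<And>x. x \<in> S \<Longrightarrow> metric_matrix h c x $ 1 $ 2 = F x"
      "\<And>x. x \<in> S \<Longrightarrow> metric_matrix h c x $ 2 $ 1 = F x"
      "\<And>x. x \<in> S \<Longrightarrow> metric_matrix h c x $ 2 $ 2 = G (x $ 2)"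
    and D: "\<And>x. x \<in> S \<Longrightarrow> E (x $ 1) * G (x $ 2) - (F x)\<^sup>2 > 0"
    and E: "\<And>x. x \<in> S \<Longrightarrow> (E has_real_derivative E' (x $ 1)) (at (x $ 1))"
    and G: "\<And>x. x \<in> S \<Longrightarrow> (G has_real_derivative G' (x $ 2)) (at (x $ 2))"
    and G': "\<And>x. x \<in> S \<Longrightarrow> (G' has_real_derivative G'' (x $ 2)) (at (x $ 2))"
    and F: "\<And>x. x \<in> S \<Longrightarrow> (F has_derivative (\<lambda>v. F1 x * v $ 1 + F2 x * v $ 2)) (at x)"
    and F2: "\<And>x. x \<in> S \<Longrightarrow> (F2 has_derivative (\<lambda>v. F12 x * v $ 1 + F22 x * v $ 2)) (at x)"
    and p: "snd c p \<in> S"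
  defines "x0 \<equiv> snd c p"
  defines "\<Gamma>1 \<equiv> \<lambda>x. (G (x $ 2) * F2 x - F x * G' (x $ 2) / 2) / (E (x $ 1) * G (x $ 2) - (F x)\<^sup>2)"
    and "\<Gamma>2 \<equiv> \<lambda>x. (E (x $ 1) * G' (x $ 2) / 2 - F x * F2 x) / (E (x $ 1) * G (x $ 2) - (F x)\<^sup>2)"
  shows "gaussian_curvature h c p =
    (F12 x0 - E' (x0 $ 1) / 2 * \<Gamma>1 x0 - F1 x0 * \<Gamma>2 x0) / (E (x0 $ 1) * G (x0 $ 2) - (F x0)\<^sup>2)"
proof -
  let ?M = "metric_matrix h c"
  have x0: "x0 \<in> S" using p by (simp add: x0_def)
  have nth: "((\<lambda>x. x $ i) has_derivative (\<lambda>v. v $ i)) (at x)" for i :: 2 and x :: "real ^ 2"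
    by (rule bounded_linear_imp_has_derivative[OF bounded_linear_vec_nth])
  have dE: "((\<lambda>x. E (x $ 1)) has_derivative (\<lambda>v. E' (x $ 1) * v $ 1)) (at x)" if "x \<in> S" for x
    using has_derivative_compose[OF nth E[OF that, unfolded has_field_derivative_def]] .
  have dG: "((\<lambda>x. G (x $ 2)) has_derivative (\<lambda>v. G' (x $ 2) * v $ 2)) (at x)" if "x \<in> S" for x
    using has_derivative_compose[OF nth G[OF that, unfolded has_field_derivative_def]] .
  have dG': "((\<lambda>x. G' (x $ 2)) has_derivative (\<lambda>v. G'' (x $ 2) * v $ 2)) (at x)" if "x \<in> S" for x
    using has_derivative_compose[OF nth G'[OF that, unfolded has_field_derivative_def]] .
  have det: "det (?M x) = E (x $ 1) * G (x $ 2) - (F x)\<^sup>2" if "x \<in> S" for x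
    using M that by (simp add: det_2 power2_eq_square)
  have dnz: "det (?M x) \<noteq> 0" if "x \<in> S" for x using det[OF that] D[OF that] by simp
  note ax = axis_def
  have P: "partial 1 (\<lambda>y. ?M y $ 1 $ 1) x = E' (x $ 1)" "partial 2 (\<lambda>y. ?M y $ 1 $ 1) x = 0"
    "partial 1 (\<lambda>y. ?M y $ 2 $ 2) x = 0" "partial 2 (\<lambda>y. ?M y $ 2 $ 2) x = G' (x $ 2)"
    "partial 1 (\<lambda>y. ?M y $ 1 $ 2) x = F1 x" "partial 2 (\<lambda>y. ?M y $ 1 $ 2) x = F2 x"
    "partial 1 (\<lambda>y. ?M y $ 2 $ 1) x = F1 x" "partial 2 (\<lambda>y. ?M y $ 2 $ 1) x = F2 x" if x: "x \<in> S" for x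
    using partial_eqI[OF S x M(1) dE[OF x]] partial_eqI[OF S x M(4) dG[OF x]]
      partial_eqI[OF S x M(2) F[OF x]] partial_eqI[OF S x M(3) F[OF x]] by (simp_all add: ax)
  note chr = christoffel_def sum_2 matrix_inv_2x2[OF dnz]
  have C22: "christoffel h c 1 2 2 x = \<Gamma>1 x" "christoffel h c 2 2 2 x = \<Gamma>2 x" if "x \<in> S" for x
    using dnz[OF that] that unfolding \<Gamma>1_def \<Gamma>2_def det[OF that, symmetric]
    by (simp_all add: chr P M diff_divide_distrib)
  have C12: "christoffel h c m 1 2 x = 0" "christoffel h c m 2 1 x = 0" if "x \<in> S" for x m
    using that exhaust_2[of m] by (auto simp: chr P M)
  \<comment> \<open>Lowering the index gives the Christoffel symbol of the first kind, and the
    curvature needs the two symbols only in this combination.\<close>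
  have C11: "E (x $ 1) * christoffel h c 1 1 1 x + F x * christoffel h c 2 1 1 x = E' (x $ 1) / 2"
    if "x \<in> S" for x
  proof -
    have *: "christoffel h c 1 1 1 x = (G (x $ 2) * E' (x $ 1) - F x * 2 * F1 x) / 2 / det (?M x)"
      "christoffel h c 2 1 1 x = (E (x $ 1) * 2 * F1 x - F x * E' (x $ 1)) / 2 / det (?M x)"
      using that dnz[OF that] by (simp_all add: chr P M diff_divide_distrib)
    have "E (x $ 1) * christoffel h c 1 1 1 x + F x * christoffel h c 2 1 1 x =
      E' (x $ 1) / 2 * det (?M x) / det (?M x)"
      unfolding * using that by (simp add: det add_divide_distrib[symmetric] algebra_simps power2_eq_square diff_divide_distrib)
    then show ?thesis using dnz[OF that] by simp
  qed
  \<comment> \<open>Mere differentiability suffices. The curvature contains the derivatives of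
    \<open>\<Gamma>1\<close> and \<open>\<Gamma>2\<close> only in the combination obtained by
    differentiating the identity \<open>E * \<Gamma>1 + F * \<Gamma>2 = F2\<close>, again a lowered
    index, in the first direction.\<close>
  have "\<exists>D. (\<Gamma>1 has_derivative D) (at x0)" "\<exists>D. (\<Gamma>2 has_derivative D) (at x0)"
    unfolding \<Gamma>1_def \<Gamma>2_def using D[OF x0]
    by (auto intro!: exI derivative_eq_intros dE[OF x0] dG[OF x0] dG'[OF x0] F[OF x0] F2[OF x0])
  then obtain D1 D2 where D1: "(\<Gamma>1 has_derivative D1) (at x0)" and D2: "(\<Gamma>2 has_derivative D2) (at x0)"
    by blast
  have "((\<lambda>x. E (x $ 1) * \<Gamma>1 x + F x * \<Gamma>2 x) has_derivative
      (\<lambda>v. (E (x0 $ 1) * D1 v + E' (x0 $ 1) * v $ 1 * \<Gamma>1 x0) +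
        (F x0 * D2 v + (F1 x0 * v $ 1 + F2 x0 * v $ 2) * \<Gamma>2 x0))) (at x0)"
    by (intro has_derivative_add has_derivative_mult dE x0 D1 D2 F)
  moreover have "E (x $ 1) * \<Gamma>1 x + F x * \<Gamma>2 x = F2 x" if "x \<in> S" for x
  proof -
    have "E (x $ 1) * (G (x $ 2) * F2 x - F x * G' (x $ 2) / 2) + F x * (E (x $ 1) * G' (x $ 2) / 2 - F x * F2 x)
        = F2 x * det (?M x)"
      by (simp add: det[OF that] algebra_simps power2_eq_square)
    then show ?thesis
      using dnz[OF that] unfolding \<Gamma>1_def \<Gamma>2_def det[OF that, symmetric]
      by (simp add: add_divide_distrib[symmetric])
  qed
  ultimately have "(F2 has_derivative
      (\<lambda>v. (E (x0 $ 1) * D1 v + E' (x0 $ 1) * v $ 1 * \<Gamma>1 x0) +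
        (F x0 * D2 v + (F1 x0 * v $ 1 + F2 x0 * v $ 2) * \<Gamma>2 x0))) (at x0)"
    by (rule has_derivative_transform_within_open[OF _ S x0])
  from has_derivative_unique[OF this F2[OF x0]]
  have eq: "E (x0 $ 1) * D1 (axis 1 1) + E' (x0 $ 1) * \<Gamma>1 x0 + F x0 * D2 (axis 1 1) + F1 x0 * \<Gamma>2 x0 = F12 x0"
    by (auto dest!: fun_cong[of _ _ "axis 1 1"] simp: ax)
  have R: "riemann h c 1 2 1 2 x0 = D1 (axis 1 1) + christoffel h c 1 1 1 x0 * \<Gamma>1 x0"
    "riemann h c 2 2 1 2 x0 = D2 (axis 1 1) + christoffel h c 2 1 1 x0 * \<Gamma>1 x0"
    using partial_eqI[OF S x0 C22(1) D1, where i = 1] partial_eqI[OF S x0 C22(2) D2, where i = 1]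
      partial_eqI[OF S x0 C12(1) has_derivative_const, where i = 2] x0
    by (simp_all add: riemann_def sum_2 C22 C12)
  have "(\<Sum>m\<in>UNIV. ?M x0 $ 1 $ m * riemann h c m 2 1 2 x0) =
      E (x0 $ 1) * D1 (axis 1 1) + F x0 * D2 (axis 1 1) +
      (E (x0 $ 1) * christoffel h c 1 1 1 x0 + F x0 * christoffel h c 2 1 1 x0) * \<Gamma>1 x0"
    using x0 by (simp add: sum_2 M R algebra_simps)
  also have "\<dots> = F12 x0 - E' (x0 $ 1) / 2 * \<Gamma>1 x0 - F1 x0 * \<Gamma>2 x0"
    unfolding C11[OF x0] using eq by simp
  finally show ?thesis
    unfolding gaussian_curvature_def Let_def x0_def[symmetric] det[OF x0] by simp
qed

text \<open>Dividing by the square roots of \<open>E\<close> and \<open>G\<close> turns the mixed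
  coefficient into the cosine of the angle between the coordinate curves, and the curvature formula
  into the sine-Gordon equation. The pairing \<open>A s \<bullet> B t\<close> represents the mixed
  coefficient alone; \<open>E\<close> and \<open>G\<close> are separate functions.\<close>

lemma separable_metric_curvature_zero:
  fixes A A' A'' B B' :: "real \<Rightarrow> 'v::euclidean_space" and E E' E'' G G' :: "real \<Rightarrow> real"
  assumes lr: "l < r" and pq: "p < q"
    and A: "\<And>s. s \<in> {l<..<r} \<Longrightarrow> (A has_vector_derivative A' s) (at s)"
    and A': "\<And>s. s \<in> {l<..<r} \<Longrightarrow> (A' has_vector_derivative A'' s) (at s)"
    and E: "\<And>s. s \<in> {l<..<r} \<Longrightarrow> (E has_real_derivative E' s) (at s)"
    and E': "\<And>s. s \<in> {l<..<r} \<Longrightarrow> (E' has_real_derivative E'' s) (at s)"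
    and B: "\<And>t. t \<in> {p<..<q} \<Longrightarrow> (B has_vector_derivative B' t) (at t)"
    and G: "\<And>t. t \<in> {p<..<q} \<Longrightarrow> (G has_real_derivative G' t) (at t)"
    and E_pos: "\<And>s. s \<in> {l<..<r} \<Longrightarrow> E s > 0" and G_pos: "\<And>t. t \<in> {p<..<q} \<Longrightarrow> G t > 0"
    and disc: "\<And>s t. s \<in> {l<..<r} \<Longrightarrow> t \<in> {p<..<q} \<Longrightarrow> E s * G t - (A s \<bullet> B t)\<^sup>2 > 0"
    and K: "\<And>s t. s \<in> {l<..<r} \<Longrightarrow> t \<in> {p<..<q} \<Longrightarrow>
      K = (A' s \<bullet> B' t
           - E' s / 2 * ((G t * (A s \<bullet> B' t) - (A s \<bullet> B t) * G' t / 2) / (E s * G t - (A s \<bullet> B t)\<^sup>2))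
           - (A' s \<bullet> B t) * ((E s * G' t / 2 - (A s \<bullet> B t) * (A s \<bullet> B' t)) / (E s * G t - (A s \<bullet> B t)\<^sup>2)))
          / (E s * G t - (A s \<bullet> B t)\<^sup>2)"
  shows "K = 0"
proof -
  define e \<gamma> where "e s = sqrt (E s)" and "\<gamma> t = sqrt (G t)" for s t
  define \<alpha> \<alpha>' where "\<alpha> s = (1 / e s) *\<^sub>R A s" and
    "\<alpha>' s = (1 / e s) *\<^sub>R A' s - (E' s / (2 * E s * e s)) *\<^sub>R A s" for s
  \<comment> \<open>The coefficients are the first two derivatives of \<open>1 / sqrt (E s)\<close>,
    computed in \<open>dei\<close> and \<open>dei'\<close>.\<close>
  define \<alpha>'' where "\<alpha>'' s = (1 / e s) *\<^sub>R A'' s - (E' s / (2 * E s * e s)) *\<^sub>R A' s -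
    ((E' s / (2 * E s * e s)) *\<^sub>R A' s + (E'' s / (2 * E s * e s) - 3 * (E' s)\<^sup>2 / (4 * (E s)\<^sup>2 * e s)) *\<^sub>R A s)" for s
  define \<beta> \<beta>' where "\<beta> t = (1 / \<gamma> t) *\<^sub>R B t" and
    "\<beta>' t = (1 / \<gamma> t) *\<^sub>R B' t - (G' t / (2 * G t * \<gamma> t)) *\<^sub>R B t" for t
  have e: "e s > 0" "e s * e s = E s" if "s \<in> {l<..<r}" for s using E_pos[OF that] by (simp_all add: e_def)
  have \<gamma>: "\<gamma> t > 0" "\<gamma> t * \<gamma> t = G t" if "t \<in> {p<..<q}" for t using G_pos[OF that] by (simp_all add: \<gamma>_def)
  have de: "(e has_real_derivative E' s / (2 * e s)) (at s)" if "s \<in> {l<..<r}" for s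
    unfolding e_def using E_pos[OF that] by (auto intro!: derivative_eq_intros E[OF that] simp: field_simps)
  have d\<gamma>: "(\<gamma> has_real_derivative G' t / (2 * \<gamma> t)) (at t)" if "t \<in> {p<..<q}" for t
    unfolding \<gamma>_def using G_pos[OF that] by (auto intro!: derivative_eq_intros G[OF that] simp: field_simps)
  have dei: "((\<lambda>s. 1 / e s) has_real_derivative - (E' s / (2 * E s * e s))) (at s)" if s: "s \<in> {l<..<r}" for s
    using e(1)[OF s] unfolding e(2)[OF s, symmetric]
    by (auto intro!: derivative_eq_intros de[OF s] simp: field_simps)
  have d\<gamma>i: "((\<lambda>t. 1 / \<gamma> t) has_real_derivative - (G' t / (2 * G t * \<gamma> t))) (at t)" if t: "t \<in> {p<..<q}" for t
    using \<gamma>(1)[OF t] unfolding \<gamma>(2)[OF t, symmetric]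
    by (auto intro!: derivative_eq_intros d\<gamma>[OF t] simp: field_simps)
  have dei': "((\<lambda>s. E' s / (2 * E s * e s)) has_real_derivative
      E'' s / (2 * E s * e s) - 3 * (E' s)\<^sup>2 / (4 * (E s)\<^sup>2 * e s)) (at s)" if s: "s \<in> {l<..<r}" for s
  proof -
    have "((\<lambda>s. E' s / (2 * E s * e s)) has_real_derivative
      (E'' s * (2 * E s * e s) - E' s * (2 * (E' s * e s + E s * (E' s / (2 * e s))))) / (2 * E s * e s)\<^sup>2) (at s)"
      using e(1)[OF s] E_pos[OF s]
      by (auto intro!: derivative_eq_intros de[OF s] E[OF s] E'[OF s] simp: power2_eq_square)
    moreover have "(E'' s * (2 * E s * e s) - E' s * (2 * (E' s * e s + E s * (E' s / (2 * e s))))) / (2 * E s * e s)\<^sup>2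
      = E'' s / (2 * E s * e s) - 3 * (E' s)\<^sup>2 / (4 * (E s)\<^sup>2 * e s)"
      using e(1)[OF s] unfolding e(2)[OF s, symmetric]
      by (simp add: field_simps power2_eq_square)
    ultimately show ?thesis by simp
  qed
  show ?thesis
  proof (rule separable_sine_Gordon_zero[OF lr pq, where \<alpha> = \<alpha> and \<alpha>' = \<alpha>' and \<alpha>'' = \<alpha>'' and \<beta> = \<beta> and \<beta>' = \<beta>'
        and e = e and \<gamma> = \<gamma> and e' = "\<lambda>s. E' s / (2 * e s)"])
    fix s assume s: "s \<in> {l<..<r}"
    show "(\<alpha> has_vector_derivative \<alpha>' s) (at s)"
      unfolding \<alpha>_def \<alpha>'_def
      using has_vector_derivative_scaleR[OF dei[OF s] A[OF s]] by simp
    show "(\<alpha>' has_vector_derivative \<alpha>'' s) (at s)"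
      unfolding \<alpha>'_def \<alpha>''_def
      using has_vector_derivative_diff[OF has_vector_derivative_scaleR[OF dei[OF s] A'[OF s]]
          has_vector_derivative_scaleR[OF dei'[OF s] A[OF s]]] by simp
    show "(e has_real_derivative E' s / (2 * e s)) (at s)" by (rule de[OF s])
    show "e s \<noteq> 0" using e[OF s] by simp
  next
    fix t assume t: "t \<in> {p<..<q}"
    show "(\<beta> has_vector_derivative \<beta>' t) (at t)"
      unfolding \<beta>_def \<beta>'_def
      using has_vector_derivative_scaleR[OF d\<gamma>i[OF t] B[OF t]] by simp
    show "\<gamma> t \<noteq> 0" using \<gamma>[OF t] by simp
  next
    show "continuous_on {p<..<q} \<gamma>"
      using d\<gamma> by (intro continuous_at_imp_continuous_on) (blast intro: DERIV_isCont)
  next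
    fix s t assume s: "s \<in> {l<..<r}" and t: "t \<in> {p<..<q}"
    \<comment> \<open>What remains is a rational identity in these numbers and \<open>K\<close>;
      writing \<open>E s\<close> and \<open>G t\<close> as squares of \<open>a\<close> and
      \<open>b\<close> eliminates the roots.\<close>
    define f P Q R a b a' b' where "f = A s \<bullet> B t" and "P = A' s \<bullet> B t" and "Q = A s \<bullet> B' t" and "R = A' s \<bullet> B' t"
      and "a = e s" and "b = \<gamma> t" and "a' = E' s" and "b' = G' t"
    define D where "D = a * a * b * b - f * f"
    have pos: "a > 0" "b > 0" using e[OF s] \<gamma>[OF t] by (auto simp: a_def b_def)
    have EG: "E s = a * a" "G t = b * b" using e[OF s] \<gamma>[OF t] by (auto simp: a_def b_def)
    have DD: "E s * G t - (A s \<bullet> B t)\<^sup>2 = D" by (simp add: D_def EG f_def power2_eq_square mult.assoc)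
    have Dpos: "D > 0" using disc[OF s t] DD by simp
    have KD: "K * D * D = R * D - a' / 2 * (b * b * Q - f * b' / 2) - P * (a * a * b' / 2 - f * Q)"
    proof -
      have "K = (R - a' / 2 * ((b * b * Q - f * b' / 2) / D) - P * ((a * a * b' / 2 - f * Q) / D)) / D"
        using K[OF s t] unfolding DD unfolding EG f_def P_def Q_def R_def a'_def b'_def .
      moreover have "(R - u * (v / D) - P * (z / D)) / D * D * D = R * D - u * v - P * z" for u v z
        using Dpos by (simp add: left_diff_distrib diff_divide_distrib)
      ultimately show ?thesis by metis
    qed
    have i: "\<alpha> s \<bullet> \<beta> t = f / (a * b)" "\<alpha>' s \<bullet> \<beta> t = (P - a' * f / (2 * a * a)) / (a * b)"
      "\<alpha> s \<bullet> \<beta>' t = (Q - b' * f / (2 * b * b)) / (a * b)"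
      "\<alpha>' s \<bullet> \<beta>' t = (R - a' * Q / (2 * a * a) - b' * P / (2 * b * b) + a' * b' * f / (4 * a * a * b * b)) / (a * b)"
      unfolding \<alpha>_def \<alpha>'_def \<beta>_def \<beta>'_def f_def P_def Q_def R_def a'_def b'_def
      using pos by (simp_all add: inner_diff_left inner_diff_right EG a_def[symmetric] b_def[symmetric] field_simps)
    have d: "1 - (f / (a * b))\<^sup>2 = D / (a * a * b * b)"
      using pos by (simp add: D_def field_simps power2_eq_square)
    show "(\<alpha> s \<bullet> \<beta> t)\<^sup>2 < 1"
    proof -
      have "D / (a * a * b * b) > 0" using Dpos pos by simp
      then show ?thesis using d by (simp add: i)
    qed
    have "(R - a' * Q / (2 * a * a) - b' * P / (2 * b * b) + a' * b' * f / (4 * a * a * b * b)) * D +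
        f * (P - a' * f / (2 * a * a)) * (Q - b' * f / (2 * b * b)) = K * D * D"
      unfolding KD using pos by (simp add: D_def field_simps)
    then have "(R - a' * Q / (2 * a * a) - b' * P / (2 * b * b) + a' * b' * f / (4 * a * a * b * b)) +
        f * (P - a' * f / (2 * a * a)) * (Q - b' * f / (2 * b * b)) / D = K * D"
      using Dpos by (simp add: field_simps)
    then have "K * a * b * (D / (a * a * b * b)) = ((R - a' * Q / (2 * a * a) - b' * P / (2 * b * b) + a' * b' * f / (4 * a * a * b * b)) +
        f * (P - a' * f / (2 * a * a)) * (Q - b' * f / (2 * b * b)) / D) / (a * b)"
      using pos by (simp add: field_simps)
    also have "\<dots> = (R - a' * Q / (2 * a * a) - b' * P / (2 * b * b) + a' * b' * f / (4 * a * a * b * b)) / (a * b) +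
        (f / (a * b)) * ((P - a' * f / (2 * a * a)) / (a * b)) * ((Q - b' * f / (2 * b * b)) / (a * b)) / (D / (a * a * b * b))"
    proof -
      have "(f / (a * b)) * (X / (a * b)) * (Y / (a * b)) / (D / (a * a * b * b)) = f * X * Y / D / (a * b)" for X Y
        using pos Dpos by (simp add: field_simps)
      then show ?thesis by (simp only: add_divide_distrib)
    qed
    finally show "\<alpha>' s \<bullet> \<beta>' t + (\<alpha> s \<bullet> \<beta> t) * (\<alpha>' s \<bullet> \<beta> t) * (\<alpha> s \<bullet> \<beta>' t) / (1 - (\<alpha> s \<bullet> \<beta> t)\<^sup>2) =
        K * e s * \<gamma> t * (1 - (\<alpha> s \<bullet> \<beta> t)\<^sup>2)"
      unfolding i d a_def[symmetric] b_def[symmetric] by simp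
  qed
qed

section \<open>Smooth maps into Lie groups\<close>

text \<open>Maps from open subsets of Euclidean spaces, avoiding the atlas of their domain.\<close>

definition smooth_param ::
    "'a topology \<Rightarrow> ('a, 'e::euclidean_space) chart set \<Rightarrow> 'd::euclidean_space set \<Rightarrow> ('d \<Rightarrow> 'a) \<Rightarrow> bool" where
  "smooth_param X A S u \<longleftrightarrow> open S \<and> continuous_map (top_of_set S) X u \<and>
     (\<forall>c\<in>A. \<forall>k. C_k_on k (\<lambda>x. snd c (u x)) {x \<in> S. u x \<in> fst c})"

definition velocity :: "('a, 'e::euclidean_space) chart \<Rightarrow> ('d::euclidean_space \<Rightarrow> 'a) \<Rightarrow> 'd \<Rightarrow> 'd \<Rightarrow> 'e" where
  "velocity c u x = frechet_derivative (\<lambda>y. snd c (u y)) (at x)"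

lemma smooth_paramD:
  assumes "smooth_param X A S u"
  shows "open S" "continuous_map (top_of_set S) X u" "x \<in> S \<Longrightarrow> u x \<in> topspace X"
    "c \<in> A \<Longrightarrow> C_k_on k (\<lambda>x. snd c (u x)) {x \<in> S. u x \<in> fst c}"
  using assms continuous_map_image_subset_topspace[of "top_of_set S" X u]
  by (auto simp: smooth_param_def)

lemma open_continuous_map_preimage:
  assumes "open S" "continuous_map (top_of_set S) X u" "openin X U"
  shows "open {x \<in> S. u x \<in> U}"
proof -
  have "openin (top_of_set S) {x \<in> topspace (top_of_set S). u x \<in> U}"
    using assms(2,3) by (rule openin_continuous_map_preimage)
  then show ?thesis using assms(1) by (simp add: openin_open_eq)
qed

lemmas smooth_param_open = open_continuous_map_preimage[OF smooth_paramD(1,2)]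

section \<open>Charts and their inverses as parametrizations\<close>

lemma smooth_manifold_chart:
  assumes "smooth_manifold X A" "c \<in> A"
  shows "openin X (fst c)" "open (snd c ` fst c)" "inj_on (snd c) (fst c)"
    "continuous_map (top_of_set (snd c ` fst c)) X (inv_into (fst c) (snd c))"
proof -
  have ch: "is_chart X c" using assms by (auto simp: smooth_manifold_def)
  then show op: "openin X (fst c)" "open (snd c ` fst c)" by (auto simp: is_chart_def)
  have ts: "topspace (subtopology X (fst c)) = fst c"
    by (rule topspace_subtopology_subset[OF openin_subset[OF op(1)]])
  have hm: "homeomorphic_map (subtopology X (fst c)) (top_of_set (snd c ` fst c)) (snd c)"
    using ch by (simp add: is_chart_def)
  then show inj: "inj_on (snd c) (fst c)" using homeomorphic_imp_injective_map ts by fastforce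
  obtain h where h: "homeomorphic_maps (subtopology X (fst c)) (top_of_set (snd c ` fst c)) (snd c) h"
    using hm homeomorphic_map_maps by blast
  then have "continuous_map (top_of_set (snd c ` fst c)) (subtopology X (fst c)) h"
    and hinv: "\<And>x. x \<in> fst c \<Longrightarrow> h (snd c x) = x"
    using ts by (auto simp: homeomorphic_maps_def)
  then have "continuous_map (top_of_set (snd c ` fst c)) X h" using continuous_map_into_fulltopology by blast
  then show "continuous_map (top_of_set (snd c ` fst c)) X (inv_into (fst c) (snd c))"
    by (rule continuous_map_eq) (auto simp: hinv inv_into_f_f[OF inj])
qed

lemma smooth_manifold_cover:
  "smooth_manifold X A \<Longrightarrow> p \<in> topspace X \<Longrightarrow> \<exists>c\<in>A. p \<in> fst c"
  by (auto simp: smooth_manifold_def)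

text \<open>In another chart the inverse of a chart is a transition map, so this is compatibility
  restated.\<close>

lemma smooth_param_chart_inverse:
  assumes "smooth_manifold X A" "c \<in> A"
  shows "smooth_param X A (snd c ` fst c) (inv_into (fst c) (snd c))"
  unfolding smooth_param_def
proof (intro conjI ballI allI)
  note ch = smooth_manifold_chart[OF assms]
  show "open (snd c ` fst c)" "continuous_map (top_of_set (snd c ` fst c)) X (inv_into (fst c) (snd c))"
    by (fact ch)+
  fix d k assume "d \<in> A"
  then have "compatible c d" using assms by (auto simp: smooth_manifold_def)
  then have "C_k_on k (in_charts c d (\<lambda>p. p)) (snd c ` (fst c \<inter> fst d))"
    by (simp add: compatible_def smooth_on_def)
  moreover have "in_charts c d (\<lambda>p. p) = (\<lambda>x. snd d (inv_into (fst c) (snd c) x))"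
    by (simp add: in_charts_def fun_eq_iff)
  moreover have "snd c ` (fst c \<inter> fst d) = {x \<in> snd c ` fst c. inv_into (fst c) (snd c) x \<in> fst d}"
    by (auto simp: inv_into_f_f[OF ch(3)])
  ultimately show "C_k_on k (\<lambda>x. snd d (inv_into (fst c) (snd c) x))
      {x \<in> snd c ` fst c. inv_into (fst c) (snd c) x \<in> fst d}" by simp
qed

lemma smooth_param_const:
  assumes "open S" "p \<in> topspace X"
  shows "smooth_param X A S (\<lambda>x. p)"
  using assms by (simp add: smooth_param_def C_k_on_const)

section \<open>Group operations on parametrizations, and their velocities\<close>

context
  fixes G :: "('a, 'm) monoid_scheme" (structure) and X :: "'a topology"
    and A :: "('a, 'e::euclidean_space) chart set"
  assumes lie: "lie_group G X A"
begin

lemma lie_group_manifold: "smooth_manifold X A" and lie_group_group: "group G"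
  and lie_group_topspace: "topspace X = carrier G"
  using lie by (simp_all add: lie_group_def)

interpretation group G by (rule lie_group_group)

lemmas lie_group_chart = smooth_manifold_chart[OF lie_group_manifold]

lemma smooth_param_carrier: "smooth_param X A S u \<Longrightarrow> x \<in> S \<Longrightarrow> u x \<in> carrier G"
  using smooth_paramD(3) lie_group_topspace by metis

lemma smooth_param_compose:
  assumes "smooth_param X A S u" "open T" "\<And>k. C_k_on k f T" "f ` T \<subseteq> S"
  shows "smooth_param X A T (\<lambda>x. u (f x))"
  unfolding smooth_param_def
proof (intro conjI ballI allI)
  note u = smooth_paramD[OF assms(1)]
  have cf: "continuous_on T f" using assms(3)[of 0] by simp
  then have "continuous_map (top_of_set T) (top_of_set S) f" using assms(4) by auto
  from continuous_map_compose[OF this u(2)]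
  show cont: "continuous_map (top_of_set T) X (\<lambda>x. u (f x))" by (simp add: o_def)
  fix c k assume c: "c \<in> A"
  show "C_k_on k (\<lambda>x. snd c (u (f x))) {x \<in> T. u (f x) \<in> fst c}"
    by (rule C_k_on_compose[OF _ _ u(4)[OF c] C_k_on_subset[OF assms(3)]])
      (use assms(4) in \<open>auto intro: open_continuous_map_preimage[OF assms(2) cont lie_group_chart(1)[OF c]]\<close>)
qed (fact assms)

text \<open>Multiplication is smooth in product charts, but a product chart covers the pair of
  factors only near a given parameter; \<open>C_k_on_local\<close> joins the pieces.\<close>

lemma smooth_param_mult:
  assumes u: "smooth_param X A S u" and w: "smooth_param X A S w"
  shows "smooth_param X A S (\<lambda>x. u x \<otimes> w x)"
  unfolding smooth_param_def
proof (intro conjI ballI allI)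
  let ?m = "\<lambda>(x, y). x \<otimes> y"
  have m: "smooth_map (prod_topology X X) (prod_atlas A A) X A ?m" using lie by (simp add: lie_group_def)
  show S: "open S" by (rule smooth_paramD(1)[OF u])
  have "continuous_map (top_of_set S) (prod_topology X X) (\<lambda>x. (u x, w x))"
    by (intro continuous_map_pairedI smooth_paramD(2)[OF u] smooth_paramD(2)[OF w])
  moreover have "continuous_map (prod_topology X X) X ?m" using m by (simp add: smooth_map_def)
  ultimately have "continuous_map (top_of_set S) X (?m \<circ> (\<lambda>x. (u x, w x)))"
    by (rule continuous_map_compose)
  then show cont: "continuous_map (top_of_set S) X (\<lambda>x. u x \<otimes> w x)" by (simp add: o_def)
  fix d k assume d: "d \<in> A"
  show "C_k_on k (\<lambda>x. snd d (u x \<otimes> w x)) {x \<in> S. u x \<otimes> w x \<in> fst d}"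
  proof (rule C_k_on_local)
    fix x0 assume x0: "x0 \<in> {x \<in> S. u x \<otimes> w x \<in> fst d}"
    then obtain c1 c2 where c: "c1 \<in> A" "c2 \<in> A" "u x0 \<in> fst c1" "w x0 \<in> fst c2"
      using smooth_manifold_cover[OF lie_group_manifold] smooth_paramD(3)[OF u] smooth_paramD(3)[OF w] by blast
    define c where "c = (fst c1 \<times> fst c2, map_prod (snd c1) (snd c2))"
    have cP: "c \<in> prod_atlas A A" unfolding prod_atlas_def c_def using c(1,2) by blast
    have inj: "inj_on (snd c) (fst c)"
      using lie_group_chart(3)[OF c(1)] lie_group_chart(3)[OF c(2)] by (auto simp: c_def inj_on_def)
    define N where "N = {x \<in> S. u x \<in> fst c1} \<inter> {x \<in> S. w x \<in> fst c2} \<inter> {x \<in> S. u x \<otimes> w x \<in> fst d}"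
    have N: "open N"
      unfolding N_def
      by (intro open_Int smooth_param_open[OF u u] smooth_param_open[OF w w] lie_group_chart c
          open_continuous_map_preimage[OF S cont] d)
    have ck: "C_k_on k (in_charts c d ?m) (snd c ` (fst c \<inter> ?m -` fst d))"
      using m cP d unfolding smooth_map_def smooth_on_def by blast
    have eq: "in_charts c d ?m (snd c1 (u x), snd c2 (w x)) = snd d (u x \<otimes> w x)" if "x \<in> N" for x
    proof -
      have "(u x, w x) \<in> fst c" using that by (simp add: c_def N_def)
      from inv_into_f_f[OF inj this] show ?thesis by (simp add: in_charts_def c_def)
    qed
    have "C_k_on k (\<lambda>x. in_charts c d ?m (snd c1 (u x), snd c2 (w x))) N"
    proof (rule C_k_on_compose[OF N _ ck C_k_on_Pair[OF N]])
      show "(\<lambda>x. (snd c1 (u x), snd c2 (w x))) ` N \<subseteq> snd c ` (fst c \<inter> ?m -` fst d)"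
      proof safe
        fix x assume "x \<in> N"
        then show "(snd c1 (u x), snd c2 (w x)) \<in> snd c ` (fst c \<inter> ?m -` fst d)"
          by (intro image_eqI[of _ _ "(u x, w x)"]) (auto simp: c_def N_def)
      qed
      show "C_k_on k (\<lambda>x. snd c1 (u x)) N" "C_k_on k (\<lambda>x. snd c2 (w x)) N"
        using smooth_paramD(4)[OF u c(1)] smooth_paramD(4)[OF w c(2)]
        by (auto intro: C_k_on_subset simp: N_def)
    qed
    then have "C_k_on k (\<lambda>x. snd d (u x \<otimes> w x)) N"
      by (subst C_k_on_cong[OF N eq[symmetric]])
    then show "\<exists>N. open N \<and> x0 \<in> N \<and> N \<subseteq> {x \<in> S. u x \<otimes> w x \<in> fst d} \<and>
        C_k_on k (\<lambda>x. snd d (u x \<otimes> w x)) N"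
      using N x0 c by (intro exI[of _ N]) (auto simp: N_def)
  qed
qed

lemma smooth_param_inv:
  assumes u: "smooth_param X A S u"
  shows "smooth_param X A S (\<lambda>x. inv (u x))"
  unfolding smooth_param_def
proof (intro conjI ballI allI)
  let ?m = "\<lambda>x. inv x"
  have m: "smooth_map X A X A ?m" using lie by (simp add: lie_group_def)
  show S: "open S" by (rule smooth_paramD(1)[OF u])
  have "continuous_map X X ?m" using m by (simp add: smooth_map_def)
  from continuous_map_compose[OF smooth_paramD(2)[OF u] this]
  show cont: "continuous_map (top_of_set S) X (\<lambda>x. inv (u x))" by (simp add: o_def)
  fix d k assume d: "d \<in> A"
  show "C_k_on k (\<lambda>x. snd d (inv (u x))) {x \<in> S. inv (u x) \<in> fst d}"
  proof (rule C_k_on_local)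
    fix x0 assume x0: "x0 \<in> {x \<in> S. inv (u x) \<in> fst d}"
    then obtain c where c: "c \<in> A" "u x0 \<in> fst c"
      using smooth_manifold_cover[OF lie_group_manifold] smooth_paramD(3)[OF u] by blast
    define N where "N = {x \<in> S. u x \<in> fst c} \<inter> {x \<in> S. inv (u x) \<in> fst d}"
    have N: "open N"
      unfolding N_def
      by (intro open_Int smooth_param_open[OF u u] lie_group_chart c open_continuous_map_preimage[OF S cont] d)
    have ck: "C_k_on k (in_charts c d ?m) (snd c ` (fst c \<inter> ?m -` fst d))"
      using m c(1) d unfolding smooth_map_def smooth_on_def by blast
    have eq: "in_charts c d ?m (snd c (u x)) = snd d (inv (u x))" if "x \<in> N" for x
      using that by (simp add: in_charts_def N_def inv_into_f_f[OF lie_group_chart(3)[OF c(1)]])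
    have "C_k_on k (\<lambda>x. in_charts c d ?m (snd c (u x))) N"
    proof (rule C_k_on_compose[OF N _ ck])
      show "(\<lambda>x. snd c (u x)) ` N \<subseteq> snd c ` (fst c \<inter> ?m -` fst d)" by (auto simp: N_def)
      show "C_k_on k (\<lambda>x. snd c (u x)) N"
        using smooth_paramD(4)[OF u c(1)] by (auto intro: C_k_on_subset simp: N_def)
    qed
    then have "C_k_on k (\<lambda>x. snd d (inv (u x))) N"
      by (subst C_k_on_cong[OF N eq[symmetric]])
    then show "\<exists>N. open N \<and> x0 \<in> N \<and> N \<subseteq> {x \<in> S. inv (u x) \<in> fst d} \<and>
        C_k_on k (\<lambda>x. snd d (inv (u x))) N"
      using N x0 c by (intro exI[of _ N]) (auto simp: N_def)
  qed
qed

lemma velocity_has_derivative: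
  assumes "smooth_param X A S u" "c \<in> A" "x \<in> S" "u x \<in> fst c"
  shows "((\<lambda>y. snd c (u y)) has_derivative velocity c u x) (at x)"
  unfolding velocity_def
  by (rule C_k_on_SucD[OF smooth_paramD(4)[OF assms(1,2), of "Suc 0"]]) (use assms in simp)

text \<open>The chain rule in charts. It links \<open>differential\<close>, in which isometries are
  expressed, with velocities of parametrizations.\<close>

lemma velocity_eq_differential:
  assumes u: "smooth_param X A S u" and c: "c \<in> A" and d: "d \<in> A" and x: "x \<in> S" "u x \<in> fst c" "f (u x) \<in> fst d"
    and f: "smooth_param X A (snd c ` fst c) (\<lambda>y. f (inv_into (fst c) (snd c) y))"
  shows "velocity d (\<lambda>y. f (u y)) x = (\<lambda>v. differential c d f (u x) (velocity c u x v))"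
proof -
  note inv = inv_into_f_f[OF lie_group_chart(3)[OF c]]
  have "in_charts c d f = (\<lambda>y. snd d (f (inv_into (fst c) (snd c) y)))" by (simp add: in_charts_def fun_eq_iff)
  then have "(in_charts c d f has_derivative differential c d f (u x)) (at (snd c (u x)))"
    using velocity_has_derivative[OF f d, of "snd c (u x)"] x inv
    by (simp add: velocity_def differential_def)
  from has_derivative_compose[OF velocity_has_derivative[OF u c x(1,2)] this]
  have "((\<lambda>y. snd d (f (u y))) has_derivative (\<lambda>v. differential c d f (u x) (velocity c u x v))) (at x)"
    by (rule has_derivative_transform_within_open[OF _ smooth_param_open[OF u u lie_group_chart(1)[OF c]]])
      (use x inv in \<open>auto simp: in_charts_def\<close>)
  then show ?thesis unfolding velocity_def using frechet_derivative_at by metis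
qed

text \<open>A directional derivative sees only the restriction to a line, so maps on different
  domains can be compared: the surface along a coordinate line, and the two-parameter map behind a
  logarithmic derivative.\<close>

lemma velocity_along_line:
  assumes u: "smooth_param X A S u" and w: "smooth_param X A T w" and c: "c \<in> A"
    and x: "x \<in> S" "u x \<in> fst c" and y: "y \<in> T" "w y \<in> fst c"
    and N: "open N" "0 \<in> N" "\<And>r. r \<in> N \<Longrightarrow> u (x + r *\<^sub>R v) = w (y + r *\<^sub>R v')"
  shows "velocity c u x v = velocity c w y v'"
proof -
  have line: "((\<lambda>r. z (p + r *\<^sub>R q)) has_vector_derivative D q) (at 0)"
    if "(z has_derivative D) (at p)" for z :: "'x::euclidean_space \<Rightarrow> 'e" and D p q
  proof -
    have "((\<lambda>r::real. p + r *\<^sub>R q) has_derivative (\<lambda>r. r *\<^sub>R q)) (at 0)"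
      by (auto intro!: derivative_eq_intros)
    then have "((\<lambda>r. z (p + r *\<^sub>R q)) has_derivative (\<lambda>r. D (r *\<^sub>R q))) (at 0)"
      by (rule has_derivative_compose) (simp add: that)
    then show ?thesis
      by (simp add: has_vector_derivative_def linear_scale[OF has_derivative_linear[OF that]])
  qed
  have "((\<lambda>r. snd c (u (x + r *\<^sub>R v))) has_vector_derivative velocity c u x v) (at 0)"
    by (rule line[OF velocity_has_derivative[OF u c x]])
  then have "((\<lambda>r. snd c (w (y + r *\<^sub>R v'))) has_vector_derivative velocity c u x v) (at 0)"
    by (rule has_vector_derivative_transform_within_open[OF _ N(1,2)]) (simp add: N(3))
  moreover have "((\<lambda>r. snd c (w (y + r *\<^sub>R v'))) has_vector_derivative velocity c w y v') (at 0)"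
    by (rule line[OF velocity_has_derivative[OF w c y]])
  ultimately show ?thesis by (rule vector_derivative_unique_at)
qed

text \<open>The logarithmic derivatives \<open>a\<inverse> a'\<close> and \<open>b' b\<inverse>\<close>, as components in a chart at the
  identity.\<close>

definition left_log :: "('a, 'e) chart \<Rightarrow> (real \<Rightarrow> 'a) \<Rightarrow> real \<Rightarrow> 'e" where
  "left_log d a s = velocity d (\<lambda>p. inv (a (fst p)) \<otimes> a (snd p)) (s, s) (0, 1)"

definition right_log :: "('a, 'e) chart \<Rightarrow> (real \<Rightarrow> 'a) \<Rightarrow> real \<Rightarrow> 'e" where
  "right_log d b t = velocity d (\<lambda>p. b (snd p) \<otimes> inv (b (fst p))) (t, t) (0, 1)"

lemma smooth_param_log:
  assumes "smooth_param X A I a"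
  shows "smooth_param X A (I \<times> I) (\<lambda>p. inv (a (fst p)) \<otimes> a (snd p))"
    "smooth_param X A (I \<times> I) (\<lambda>p. a (snd p) \<otimes> inv (a (fst p)))"
proof -
  have "open (I \<times> I)" using smooth_paramD(1)[OF assms] by (intro open_Times)
  then have "smooth_param X A (I \<times> I) (\<lambda>p. a (fst p))" "smooth_param X A (I \<times> I) (\<lambda>p. a (snd p))"
    by (auto intro!: smooth_param_compose[OF assms] C_k_on_bounded_linear bounded_linear_fst bounded_linear_snd)
  then show "smooth_param X A (I \<times> I) (\<lambda>p. inv (a (fst p)) \<otimes> a (snd p))"
    "smooth_param X A (I \<times> I) (\<lambda>p. a (snd p) \<otimes> inv (a (fst p)))"
    by (auto intro!: smooth_param_mult smooth_param_inv)
qed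

text \<open>This is why the logarithmic derivatives are defined with two parameters, one frozen and
  one moving: their smoothness in \<open>s\<close> is that of a partial derivative restricted to the
  diagonal.\<close>

lemma C_k_on_diagonal_velocity:
  assumes u: "smooth_param X A (I \<times> I) u" and d: "d \<in> A" and I: "open I"
    and diag: "\<And>s. s \<in> I \<Longrightarrow> u (s, s) \<in> fst d"
  shows "C_k_on k (\<lambda>s :: real. velocity d u (s, s) v) I"
proof -
  let ?T = "{p \<in> I \<times> I. u p \<in> fst d}"
  have "C_k_on (Suc k) (\<lambda>p. snd d (u p)) ?T" by (rule smooth_paramD(4)[OF u d])
  then have "C_k_on k (\<lambda>p. velocity d u p v) ?T" unfolding C_k_on.simps velocity_def by blast
  moreover have "C_k_on k (\<lambda>s :: real. (s, s)) I"
    by (intro C_k_on_bounded_linear bounded_linear_Pair bounded_linear_ident)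
  ultimately show ?thesis by (rule C_k_on_compose[OF I, rotated]) (use diag in auto)
qed

lemma C_k_on_left_log:
  assumes a: "smooth_param X A I a" and d: "d \<in> A" "\<one> \<in> fst d"
  shows "C_k_on k (left_log d a) I"
proof -
  have "C_k_on k (\<lambda>s. velocity d (\<lambda>p. inv (a (fst p)) \<otimes> a (snd p)) (s, s) (0, 1)) I"
    by (rule C_k_on_diagonal_velocity[OF smooth_param_log(1)[OF a] d(1) smooth_paramD(1)[OF a]])
      (simp add: l_inv smooth_param_carrier[OF a] d)
  then show ?thesis by (simp add: left_log_def[abs_def])
qed

lemma C_k_on_right_log:
  assumes b: "smooth_param X A I b" and d: "d \<in> A" "\<one> \<in> fst d"
  shows "C_k_on k (right_log d b) I"
proof -
  have "C_k_on k (\<lambda>s. velocity d (\<lambda>p. b (snd p) \<otimes> inv (b (fst p))) (s, s) (0, 1)) I"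
    by (rule C_k_on_diagonal_velocity[OF smooth_param_log(2)[OF b] d(1) smooth_paramD(1)[OF b]])
      (simp add: r_inv smooth_param_carrier[OF b] d)
  then show ?thesis by (simp add: right_log_def[abs_def])
qed

lemma smooth_param_curve_product:
  assumes a: "smooth_param X A I a" and b: "smooth_param X A J b"
  shows "smooth_param X A {x :: real ^ 2. x $ 1 \<in> I \<and> x $ 2 \<in> J} (\<lambda>x. a (x $ 1) \<otimes> b (x $ 2))"
proof -
  let ?S = "{x :: real ^ 2. x $ 1 \<in> I \<and> x $ 2 \<in> J}"
  have "?S = (\<lambda>x. x $ 1) -` I \<inter> (\<lambda>x. x $ 2) -` J" by auto
  moreover have "open ((\<lambda>x :: real ^ 2. x $ 1) -` I)" "open ((\<lambda>x :: real ^ 2. x $ 2) -` J)"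
    by (intro open_vimage smooth_paramD(1)[OF a] smooth_paramD(1)[OF b] continuous_intros)+
  ultimately have "open ?S" using open_Int by metis
  then have "smooth_param X A ?S (\<lambda>x. a (x $ 1))" "smooth_param X A ?S (\<lambda>x. b (x $ 2))"
    by (auto intro!: smooth_param_compose[OF a] smooth_param_compose[OF b] C_k_on_bounded_linear bounded_linear_vec_nth)
  then show ?thesis by (rule smooth_param_mult)
qed

section \<open>Bi-invariance and the first fundamental form of a product of curves\<close>

context
  fixes g :: "('a, 'e) metric_field"
  assumes bi: "bi_invariant_metric G A g"
begin

lemma metric_two_sided_translation:
  assumes u: "smooth_param X A S u" and x: "x \<in> S" and h: "h \<in> carrier G" and k: "k \<in> carrier G"
    and c: "c \<in> A" "u x \<in> fst c" and d: "d \<in> A" "h \<otimes> u x \<otimes> k \<in> fst d"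
  shows "g d (h \<otimes> u x \<otimes> k) (velocity d (\<lambda>y. h \<otimes> u y \<otimes> k) x v) (velocity d (\<lambda>y. h \<otimes> u y \<otimes> k) x w) =
    g c (u x) (velocity c u x v) (velocity c u x w)"
proof -
  have hc: "smooth_param X A T (\<lambda>y. h)" "smooth_param X A T (\<lambda>y. k)" if "open T" for T :: "'x::euclidean_space set"
    using that h k lie_group_topspace by (auto intro: smooth_param_const)
  have uc: "u x \<in> carrier G" by (rule smooth_param_carrier[OF u x])
  obtain m where m: "m \<in> A" "h \<otimes> u x \<in> fst m"
    using smooth_manifold_cover[OF lie_group_manifold, of "h \<otimes> u x"] h uc lie_group_topspace by auto
  have S: "open S" by (rule smooth_paramD(1)[OF u])
  have hu: "smooth_param X A S (\<lambda>y. h \<otimes> u y)" by (intro smooth_param_mult hc S u)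
  have l: "velocity m (\<lambda>y. h \<otimes> u y) x = (\<lambda>v. differential c m (\<lambda>y. h \<otimes> y) (u x) (velocity c u x v))"
    by (rule velocity_eq_differential[where f = "\<lambda>y. h \<otimes> y", OF u c(1) m(1) x c(2) m(2)])
      (intro smooth_param_mult hc lie_group_chart(2) smooth_param_chart_inverse lie_group_manifold c)
  have r: "velocity d (\<lambda>y. h \<otimes> u y \<otimes> k) x =
      (\<lambda>v. differential m d (\<lambda>y. y \<otimes> k) (h \<otimes> u x) (velocity m (\<lambda>y. h \<otimes> u y) x v))"
    by (rule velocity_eq_differential[where f = "\<lambda>y. y \<otimes> k", OF hu m(1) d(1) x m(2) d(2)])
      (intro smooth_param_mult hc lie_group_chart(2) smooth_param_chart_inverse lie_group_manifold m)
  have "isometric A g A g (\<lambda>y. h \<otimes> y)" "isometric A g A g (\<lambda>y. y \<otimes> k)"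
    using bi h k by (auto simp: bi_invariant_metric_def)
  then have "g m (h \<otimes> u x) (differential c m (\<lambda>y. h \<otimes> y) (u x) v) (differential c m (\<lambda>y. h \<otimes> y) (u x) w) = g c (u x) v w"
    "g d (h \<otimes> u x \<otimes> k) (differential m d (\<lambda>y. y \<otimes> k) (h \<otimes> u x) v) (differential m d (\<lambda>y. y \<otimes> k) (h \<otimes> u x) w)
      = g m (h \<otimes> u x) v w" for v w
    using c d m unfolding isometric_def by blast+
  then show ?thesis by (simp add: l r)
qed

text \<open>Translating by the inverse of \<open>a (x $ 1)\<close> on the left and of
  \<open>b (x $ 2)\<close> on the right moves the point to the identity isometrically. Along each
  coordinate line one factor cancels, leaving the map that defines a logarithmic derivative. All
  coefficients thus come from one fixed form at the identity.\<close>

lemma metric_of_curve_product: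
  fixes x :: "real ^ 2"
  assumes a: "smooth_param X A I a" and b: "smooth_param X A J b" and e: "e \<in> A" "\<one> \<in> fst e"
    and x: "x $ 1 \<in> I" "x $ 2 \<in> J" and d: "d \<in> A" "a (x $ 1) \<otimes> b (x $ 2) \<in> fst d"
  defines "v \<equiv> \<lambda>i :: 2. if i = 1 then left_log e a (x $ 1) else right_log e b (x $ 2)"
    and "\<sigma> \<equiv> \<lambda>x :: real ^ 2. a (x $ 1) \<otimes> b (x $ 2)"
  shows "g d (\<sigma> x) (velocity d \<sigma> x (axis i 1)) (velocity d \<sigma> x (axis j 1)) = g e \<one> (v i) (v j)"
proof -
  let ?S = "{x :: real ^ 2. x $ 1 \<in> I \<and> x $ 2 \<in> J}"
  have \<sigma>: "smooth_param X A ?S \<sigma>" unfolding \<sigma>_def by (rule smooth_param_curve_product[OF a b])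
  have xS: "x \<in> ?S" using x by simp
  note ac = smooth_param_carrier[OF a] and bc = smooth_param_carrier[OF b]
  define h k where "h = inv (a (x $ 1))" and "k = inv (b (x $ 2))"
  have hk: "h \<in> carrier G" "k \<in> carrier G" using ac[OF x(1)] bc[OF x(2)] by (auto simp: h_def k_def)
  define \<tau> where "\<tau> y = h \<otimes> \<sigma> y \<otimes> k" for y
  have const: "smooth_param X A ?S (\<lambda>y. q)" if "q \<in> carrier G" for q
    using that lie_group_topspace smooth_paramD(1)[OF \<sigma>] by (auto intro: smooth_param_const)
  have \<tau>: "smooth_param X A ?S \<tau>"
    unfolding \<tau>_def by (intro smooth_param_mult const hk \<sigma>)
  have \<tau>1: "\<tau> y = h \<otimes> a (y $ 1)" if "y $ 1 \<in> I" "y $ 2 = x $ 2" for y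
    using ac[OF that(1)] bc[OF x(2)] hk that by (simp add: \<tau>_def \<sigma>_def k_def m_assoc r_inv)
  have \<tau>2: "\<tau> y = b (y $ 2) \<otimes> k" if "y $ 2 \<in> J" "y $ 1 = x $ 1" for y
  proof -
    have "\<tau> y = (h \<otimes> a (y $ 1)) \<otimes> b (y $ 2) \<otimes> k"
      using ac[OF x(1)] bc[OF that(1)] hk that by (simp add: \<tau>_def \<sigma>_def m_assoc)
    then show ?thesis
      using ac[OF x(1)] bc[OF that(1)] that by (simp add: h_def l_inv)
  qed
  have \<tau>x: "\<tau> x = \<one>" using \<tau>1[of x] x ac[OF x(1)] by (simp add: h_def l_inv)
  have near: "open {r. p + r \<in> K}" if "open K" for p :: real and K
  proof -
    have "open ((+) p -` K)" by (intro open_vimage that continuous_intros)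
    then show ?thesis by (simp add: vimage_def)
  qed
  have "velocity e \<tau> x (axis 1 1) = left_log e a (x $ 1)"
    unfolding left_log_def
    by (rule velocity_along_line[OF \<tau> smooth_param_log(1)[OF a] e(1) xS _ _ _ near[OF smooth_paramD(1)[OF a], of "x $ 1"]])
      (use x \<tau>x e ac[OF x(1)] in \<open>auto simp: \<tau>1 h_def l_inv axis_def\<close>)
  moreover have "velocity e \<tau> x (axis 2 1) = right_log e b (x $ 2)"
    unfolding right_log_def
    by (rule velocity_along_line[OF \<tau> smooth_param_log(2)[OF b] e(1) xS _ _ _ near[OF smooth_paramD(1)[OF b], of "x $ 2"]])
      (use x \<tau>x e bc[OF x(2)] in \<open>auto simp: \<tau>2 k_def r_inv axis_def\<close>)
  ultimately have vel: "velocity e \<tau> x (axis i 1) = v i" for i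
    using exhaust_2[of i] by (auto simp: v_def)
  have "h \<otimes> \<sigma> x \<otimes> k \<in> fst e" using \<tau>x e by (simp add: \<tau>_def)
  from metric_two_sided_translation[OF \<sigma> xS hk d(1) _ e(1) this] d(2)
  have "g e (\<tau> x) (velocity e \<tau> x (axis i 1)) (velocity e \<tau> x (axis j 1)) =
      g d (\<sigma> x) (velocity d \<sigma> x (axis i 1)) (velocity d \<sigma> x (axis j 1))"
    by (simp add: \<tau>_def[abs_def] \<sigma>_def)
  then show ?thesis by (simp add: vel \<tau>x)
qed

end

end

section \<open>Curvature of translation surfaces\<close>

text \<open>Absorbing the form into the second argument gives the mixed coefficient the shape of a
  Euclidean inner product of a function of \<open>s\<close> with a function of
  \<open>t\<close>.\<close>

lemma bilinear_eq_inner: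
  fixes h :: "'e::euclidean_space \<Rightarrow> 'e \<Rightarrow> real"
  assumes "bilinear h"
  shows "h u v = u \<bullet> (\<Sum>i\<in>Basis. h i v *\<^sub>R i)"
proof -
  interpret linear "\<lambda>u. h u v" using assms by (simp add: bilinear_def)
  have "h u v = h (\<Sum>i\<in>Basis. (u \<bullet> i) *\<^sub>R i) v" by (simp add: euclidean_representation)
  also have "\<dots> = (\<Sum>i\<in>Basis. (u \<bullet> i) * h i v)" by (simp add: sum scale)
  finally show ?thesis by (simp add: inner_sum_right mult.commute)
qed

lemma gram_2_positive:
  fixes L :: "real ^ 2 \<Rightarrow> 'e::euclidean_space" and h :: "'e \<Rightarrow> 'e \<Rightarrow> real"
  assumes h: "bilinear h" "\<And>v w. h v w = h w v" "\<And>v. v \<noteq> 0 \<Longrightarrow> h v v > 0"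
    and L: "linear L" "inj L"
  defines "x \<equiv> L (axis 1 1)" and "y \<equiv> L (axis 2 1)"
  shows "h x x > 0" "h y y > 0" "h x x * h y y - (h x y)\<^sup>2 > 0"
proof -
  have nz: "h (L v) (L v) > 0" if "v \<noteq> 0" for v
    using that h(3)[of "L v"] L by (metis linear_injective_0)
  show x: "h x x > 0" and y: "h y y > 0" unfolding x_def y_def by (rule nz, simp add: axis_eq_0_iff)+
  \<comment> \<open>Its image is orthogonal to \<open>y\<close> under \<open>h\<close>, a multiple
    of the component of \<open>x\<close> off \<open>y\<close>; its square is \<open>h y y\<close>
    times the Gram determinant.\<close>
  let ?v = "h y y *\<^sub>R axis 1 1 - h x y *\<^sub>R axis 2 1 :: real ^ 2"
  have "?v $ 1 \<noteq> 0" using y by (simp add: axis_def)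
  then have "?v \<noteq> 0" by (metis zero_index)
  then have "0 < h (L ?v) (L ?v)" by (rule nz)
  also have "L ?v = h y y *\<^sub>R x - h x y *\<^sub>R y"
    by (simp add: x_def y_def linear_diff[OF L(1)] linear_scale[OF L(1)])
  also have "h \<dots> \<dots> = h y y * (h x x * h y y - (h x y)\<^sup>2)"
    using h(2)[of y x]
    by (simp add: bilinear_lsub[OF h(1)] bilinear_rsub[OF h(1)] bilinear_lmul[OF h(1)] bilinear_rmul[OF h(1)]
        algebra_simps power2_eq_square)
  finally show "h x x * h y y - (h x y)\<^sup>2 > 0" using y by (simp add: zero_less_mult_iff)
qed

lemma interval_contains_nbhd:
  assumes "open I" "s \<in> I"
  obtains l r :: real where "l < r" "{l<..<r} \<subseteq> I"
proof -
  obtain e where "e > 0" "ball s e \<subseteq> I" using assms open_contains_ball by blast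
  moreover have "ball s e = {s - e<..<s + e}" by (auto simp: ball_def dist_real_def)
  ultimately show thesis using that[of "s - e" "s + e"] by auto
qed

lemma smooth_curve_imp_smooth_param:
  assumes "smooth_manifold X A" "smooth_curve I X A a"
  shows "smooth_param X A I a"
proof -
  have I: "open I" and m: "smooth_map (top_of_set I) {(I, \<lambda>t. t)} X A a"
    using assms by (auto simp: smooth_curve_def)
  show ?thesis
    unfolding smooth_param_def
  proof (intro conjI ballI allI)
    show cont: "continuous_map (top_of_set I) X a" using m by (simp add: smooth_map_def)
    fix c k assume c: "c \<in> A"
    let ?T = "{x \<in> I. a x \<in> fst c}"
    have "smooth_on (in_charts (I, \<lambda>t. t) c a) ((\<lambda>t. t) ` (I \<inter> a -` fst c))"
      using m c by (simp add: smooth_map_def)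
    moreover have "(\<lambda>t. t) ` (I \<inter> a -` fst c) = ?T" by auto
    ultimately have ck: "C_k_on k (in_charts (I, \<lambda>t. t) c a) ?T" by (simp add: smooth_on_def)
    have eq: "in_charts (I, \<lambda>t. t) c a x = snd c (a x)" if "x \<in> ?T" for x
      using that by (simp add: in_charts_def inv_into_f_f[of "\<lambda>t. t", simplified])
    have "open ?T"
      by (rule open_continuous_map_preimage[OF I cont smooth_manifold_chart(1)[OF assms(1) c]])
    from C_k_on_cong[OF this eq] ck show "C_k_on k (\<lambda>x. snd c (a x)) ?T" by simp
  qed (fact I)
qed

text \<open>The chart \<open>d x\<close> of the group may jump with \<open>x\<close>. This is
  harmless because every entry of the metric matrix is evaluated in the fixed chart \<open>e\<close>
  at the identity.\<close>

lemma curve_product_constant_curvature_zero: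
  fixes G :: "('a, 'm) monoid_scheme" (structure) and A :: "('a, 'e::euclidean_space) chart set"
    and g :: "('a, 'e) metric_field" and h :: "('s, real ^ 2) metric_field"
  assumes lie: "lie_group G X A" and bi: "bi_invariant_metric G A g"
    and a: "smooth_param X A I a" and b: "smooth_param X A J b" and ne: "s0 \<in> I" "t0 \<in> J"
  defines "\<sigma> \<equiv> \<lambda>x :: real ^ 2. a (x $ 1) \<otimes> b (x $ 2)" and "S \<equiv> {x :: real ^ 2. x $ 1 \<in> I \<and> x $ 2 \<in> J}"
  assumes d: "\<And>x. x \<in> S \<Longrightarrow> d x \<in> A \<and> \<sigma> x \<in> fst (d x)"
    and M: "\<And>x i j. x \<in> S \<Longrightarrow> metric_matrix h c x $ i $ j =
      g (d x) (\<sigma> x) (velocity (d x) \<sigma> x (axis i 1)) (velocity (d x) \<sigma> x (axis j 1))"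
    and immersed: "\<And>x. x \<in> S \<Longrightarrow> inj (velocity (d x) \<sigma> x)"
    and K: "\<And>x. x \<in> S \<Longrightarrow> \<exists>p. snd c p = x \<and> gaussian_curvature h c p = K"
  shows "K = 0"
proof -
  have man: "smooth_manifold X A" and grp: "group G" and ts: "topspace X = carrier G"
    using lie by (simp_all add: lie_group_def)
  have I: "open I" and J: "open J" using smooth_paramD(1) a b by blast+
  have \<sigma>: "smooth_param X A S \<sigma>" unfolding \<sigma>_def S_def by (rule smooth_param_curve_product[OF lie a b])
  have S: "open S" by (rule smooth_paramD(1)[OF \<sigma>])
  have "\<one> \<in> topspace X" using grp ts by (simp add: group.is_monoid)
  then obtain e where e: "e \<in> A" "\<one> \<in> fst e" using smooth_manifold_cover[OF man] by blast
  define q where "q = g e \<one>"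
  have riem: "bilinear (g m p)" "g m p v w = g m p w v" "v \<noteq> 0 \<Longrightarrow> g m p v v > 0"
    if "m \<in> A" "p \<in> fst m" for m p v w
    using bi that unfolding bi_invariant_metric_def riemannian_metric_def by blast+
  have q: "bilinear q" using riem(1)[OF e] by (simp add: q_def)
  define P R where "P = left_log G e a" and "R = right_log G e b"
  define R' where "R' t = (\<Sum>i\<in>Basis. q i (R t) *\<^sub>R i)" for t
  define E H where "E s = q (P s) (P s)" and "H t = q (R t) (R t)" for s t
  have gram: "g (d x) (\<sigma> x) (velocity (d x) \<sigma> x (axis i 1)) (velocity (d x) \<sigma> x (axis j 1)) =
      q (if i = 1 then P (x $ 1) else R (x $ 2)) (if j = 1 then P (x $ 1) else R (x $ 2))"
    if x: "x \<in> S" for x and i j :: 2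
    using metric_of_curve_product[OF lie bi a b e, of x "d x" i j] d[OF x] x
    by (simp add: q_def P_def R_def \<sigma>_def S_def)
  have entries: "metric_matrix h c x $ 1 $ 1 = E (x $ 1)" "metric_matrix h c x $ 1 $ 2 = P (x $ 1) \<bullet> R' (x $ 2)"
    "metric_matrix h c x $ 2 $ 1 = P (x $ 1) \<bullet> R' (x $ 2)" "metric_matrix h c x $ 2 $ 2 = H (x $ 2)"
    if x: "x \<in> S" for x
    using riem(2)[OF e, of "R (x $ 2)"]
    by (simp_all add: M[OF x] gram[OF x] E_def H_def R'_def flip: bilinear_eq_inner[OF q])
      (simp add: q_def)
  have pos: "E (x $ 1) > 0" "H (x $ 2) > 0" "E (x $ 1) * H (x $ 2) - (P (x $ 1) \<bullet> R' (x $ 2))\<^sup>2 > 0"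
    if x: "x \<in> S" for x
  proof -
    have dx: "d x \<in> A" "\<sigma> x \<in> fst (d x)" using d[OF x] by auto
    have "linear (velocity (d x) \<sigma> x)"
      using velocity_has_derivative[OF lie \<sigma> dx(1) x dx(2)] by (rule has_derivative_linear)
    from gram_2_positive[OF riem(1)[OF dx] riem(2)[OF dx] riem(3)[OF dx] this immersed[OF x]]
    show "E (x $ 1) > 0" "H (x $ 2) > 0" "E (x $ 1) * H (x $ 2) - (P (x $ 1) \<bullet> R' (x $ 2))\<^sup>2 > 0"
      using entries[OF x] M[OF x] by simp_all
  qed
  have CP: "C_k_on k P I" and CR: "C_k_on k R J" for k
    unfolding P_def R_def
    by (rule C_k_on_left_log[OF lie a e], rule C_k_on_right_log[OF lie b e])
  have bq: "bounded_bilinear q" using q by (simp add: bilinear_conv_bounded_bilinear)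
  have CE: "C_k_on k E I" for k unfolding E_def[abs_def] by (intro C_k_on_bilinear[OF I bq] CP)
  have CH: "C_k_on k H J" for k unfolding H_def[abs_def] by (intro C_k_on_bilinear[OF J bq] CR)
  have "linear (q i)" for i using q by (simp add: bilinear_def)
  then have "linear (\<lambda>v. \<Sum>i\<in>Basis. q i v *\<^sub>R i)"
    by (intro linear_compose_sum ballI)
      (simp add: linear_iff scaleR_add_left)
  then have CR': "C_k_on k R' J" for k
    unfolding R'_def[abs_def]
    by (intro C_k_on_compose[OF J subset_UNIV _ CR] C_k_on_bounded_linear) (simp add: linear_conv_bounded_linear)
  obtain P1 P2 where P: "\<And>s. s \<in> I \<Longrightarrow> (P has_vector_derivative P1 s) (at s)"
    "\<And>s. s \<in> I \<Longrightarrow> (P1 has_vector_derivative P2 s) (at s)"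
    using C_k_on_real_derivatives[OF CP I] by blast
  obtain Q1 Q2 where Q: "\<And>t. t \<in> J \<Longrightarrow> (R' has_vector_derivative Q1 t) (at t)"
    "\<And>t. t \<in> J \<Longrightarrow> (Q1 has_vector_derivative Q2 t) (at t)"
    using C_k_on_real_derivatives[OF CR' J] by blast
  obtain E1 E2 where E: "\<And>s. s \<in> I \<Longrightarrow> (E has_real_derivative E1 s) (at s)"
    "\<And>s. s \<in> I \<Longrightarrow> (E1 has_real_derivative E2 s) (at s)"
    using C_k_on_real_derivatives[OF CE I] unfolding has_real_derivative_iff_has_vector_derivative by blast
  obtain H1 H2 where H: "\<And>t. t \<in> J \<Longrightarrow> (H has_real_derivative H1 t) (at t)"
    "\<And>t. t \<in> J \<Longrightarrow> (H1 has_real_derivative H2 t) (at t)"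
    using C_k_on_real_derivatives[OF CH J] unfolding has_real_derivative_iff_has_vector_derivative by blast
  have inner: "((\<lambda>x. u (x $ 1) \<bullet> v (x $ 2)) has_derivative
      (\<lambda>y. (u' \<bullet> v (x $ 2)) * y $ 1 + (u (x $ 1) \<bullet> v') * y $ 2)) (at x)"
    if "(u has_vector_derivative u') (at (x $ 1))" "(v has_vector_derivative v') (at (x $ 2))"
    for u v :: "real \<Rightarrow> 'e" and u' v' and x :: "real ^ 2"
  proof -
    have nth: "((\<lambda>x. x $ i) has_derivative (\<lambda>y. y $ i)) (at x)" for i :: 2
      by (rule bounded_linear_imp_has_derivative[OF bounded_linear_vec_nth])
    have "((\<lambda>x. u (x $ 1)) has_derivative (\<lambda>y. y $ 1 *\<^sub>R u')) (at x)"
      "((\<lambda>x. v (x $ 2)) has_derivative (\<lambda>y. y $ 2 *\<^sub>R v')) (at x)"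
      using has_derivative_compose[OF nth that(1)[unfolded has_vector_derivative_def]]
        has_derivative_compose[OF nth that(2)[unfolded has_vector_derivative_def]] by simp_all
    from has_derivative_inner[OF this] show ?thesis by (simp add: add.commute mult.commute)
  qed
  have dE: "(E has_real_derivative E1 (x $ 1)) (at (x $ 1))"
    and dH: "(H has_real_derivative H1 (x $ 2)) (at (x $ 2))"
    and dH': "(H1 has_real_derivative H2 (x $ 2)) (at (x $ 2))"
    and dF: "((\<lambda>x. P (x $ 1) \<bullet> R' (x $ 2)) has_derivative
      (\<lambda>y. (P1 (x $ 1) \<bullet> R' (x $ 2)) * y $ 1 + (P (x $ 1) \<bullet> Q1 (x $ 2)) * y $ 2)) (at x)"
    and dF2: "((\<lambda>x. P (x $ 1) \<bullet> Q1 (x $ 2)) has_derivative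
      (\<lambda>y. (P1 (x $ 1) \<bullet> Q1 (x $ 2)) * y $ 1 + (P (x $ 1) \<bullet> Q2 (x $ 2)) * y $ 2)) (at x)"
    if "x \<in> S" for x
    using that by (auto simp: S_def intro!: E H inner P Q)
  have curv: "K = (P1 s \<bullet> Q1 t
      - E1 s / 2 * ((H t * (P s \<bullet> Q1 t) - (P s \<bullet> R' t) * H1 t / 2) / (E s * H t - (P s \<bullet> R' t)\<^sup>2))
      - (P1 s \<bullet> R' t) * ((E s * H1 t / 2 - (P s \<bullet> R' t) * (P s \<bullet> Q1 t)) / (E s * H t - (P s \<bullet> R' t)\<^sup>2)))
      / (E s * H t - (P s \<bullet> R' t)\<^sup>2)" if st: "s \<in> I" "t \<in> J" for s t
  proof -
    define x :: "real ^ 2" where "x = vector [s, t]"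
    have x: "x \<in> S" "x $ 1 = s" "x $ 2 = t" using st by (simp_all add: x_def S_def)
    obtain p where p: "snd c p = x" "gaussian_curvature h c p = K" using K[OF x(1)] by blast
    have "gaussian_curvature h c p = (P1 s \<bullet> Q1 t
      - E1 s / 2 * ((H t * (P s \<bullet> Q1 t) - (P s \<bullet> R' t) * H1 t / 2) / (E s * H t - (P s \<bullet> R' t)\<^sup>2))
      - (P1 s \<bullet> R' t) * ((E s * H1 t / 2 - (P s \<bullet> R' t) * (P s \<bullet> Q1 t)) / (E s * H t - (P s \<bullet> R' t)\<^sup>2)))
      / (E s * H t - (P s \<bullet> R' t)\<^sup>2)"
      unfolding x(2,3)[symmetric] p(1)[symmetric]
      by (rule gaussian_curvature_translation_metric[where S = S and G'' = H2
            and ?F22.0 = "\<lambda>x. P (x $ 1) \<bullet> Q2 (x $ 2)",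
            OF S entries pos(3) dE dH dH' dF dF2])
        (simp_all add: p(1) x(1))
    then show ?thesis using p(2) by simp
  qed
  obtain l r where lr: "l < r" "{l<..<r} \<subseteq> I" using interval_contains_nbhd[OF I ne(1)] by blast
  obtain l' r' where lr': "l' < r'" "{l'<..<r'} \<subseteq> J" using interval_contains_nbhd[OF J ne(2)] by blast
  have vec: "(vector [s, t] :: real ^ 2) \<in> S" if "s \<in> {l<..<r}" "t \<in> {l'<..<r'}" for s t
    using that lr(2) lr'(2) by (auto simp: S_def)
  show ?thesis
  proof (rule separable_metric_curvature_zero[OF lr(1) lr'(1), where A = P and A' = P1 and A'' = P2
        and B = R' and B' = Q1 and E = E and E' = E1 and E'' = E2 and G = H and G' = H1])
    fix s assume s: "s \<in> {l<..<r}"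
    then have "s \<in> I" using lr(2) by blast
    then show "(P has_vector_derivative P1 s) (at s)" "(P1 has_vector_derivative P2 s) (at s)"
      "(E has_real_derivative E1 s) (at s)" "(E1 has_real_derivative E2 s) (at s)"
      by (fact P E)+
    show "E s > 0" using pos(1)[OF vec[OF s, of "(l' + r') / 2"]] lr'(1) by simp
  next
    fix t assume t: "t \<in> {l'<..<r'}"
    then have "t \<in> J" using lr'(2) by blast
    then show "(R' has_vector_derivative Q1 t) (at t)" "(H has_real_derivative H1 t) (at t)"
      by (fact Q H)+
    show "H t > 0" using pos(2)[OF vec[OF _ t, of "(l + r) / 2"]] lr(1) by simp
  next
    fix s t assume st: "s \<in> {l<..<r}" "t \<in> {l'<..<r'}"
    show "E s * H t - (P s \<bullet> R' t)\<^sup>2 > 0" using pos(3)[OF vec[OF st]] by simp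
    show "K = (P1 s \<bullet> Q1 t
      - E1 s / 2 * ((H t * (P s \<bullet> Q1 t) - (P s \<bullet> R' t) * H1 t / 2) / (E s * H t - (P s \<bullet> R' t)\<^sup>2))
      - (P1 s \<bullet> R' t) * ((E s * H1 t / 2 - (P s \<bullet> R' t) * (P s \<bullet> Q1 t)) / (E s * H t - (P s \<bullet> R' t)\<^sup>2)))
      / (E s * H t - (P s \<bullet> R' t)\<^sup>2)"
      by (rule curv) (use st lr(2) lr'(2) in auto)
  qed
qed

theorem theorem1:
  fixes G :: "('a, 'm) monoid_scheme" and X :: "'a topology"
    and A :: "('a, real ^ 'n::finite) chart set"
    and g :: "('a, real ^ 'n) metric_field"
    and Y :: "'s topology" and B :: "('s, real ^ 2) chart set" and \<iota> :: "'s \<Rightarrow> 'a"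
  assumes "CARD('n) \<ge> 2"
    and "lie_group G X A"
    and "bi_invariant_metric G A g"
    and "regular_translation_surface G X A Y B \<iota>"
    and "\<exists>\<kappa>. constant_gaussian_curvature B (induced_metric A g \<iota>) \<kappa>"
  shows "constant_gaussian_curvature B (induced_metric A g \<iota>) 0"
proof -
  let ?h = "induced_metric A g \<iota> :: ('s, real ^ 2) metric_field"
  obtain \<kappa> where \<kappa>: "constant_gaussian_curvature B ?h \<kappa>" using assms(5) by blast
  have Y: "smooth_manifold Y B" and ts: "translation_surface G X A Y B \<iota>"
    and imm: "immersion Y B X A \<iota>"
    using assms(4) by (auto simp: regular_translation_surface_def translation_surface_def)
  have X: "smooth_manifold X A" using assms(2) by (simp add: lie_group_def)
  \<comment> \<open>One point of the surface suffices, since flatness is already forced on a single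
    product of intervals around it; on an empty surface the claim is vacuous.\<close>
  have "\<kappa> = 0" if c0: "c0 \<in> B" "p0 \<in> fst c0" for c0 p0
  proof -
    have p0: "p0 \<in> topspace Y" using openin_subset[OF smooth_manifold_chart(1)[OF Y c0(1)]] c0(2) by blast
    from bspec[OF conjunct2[OF conjunct2[OF ts[unfolded translation_surface_def]]] p0]
    obtain c I J a b where c: "c \<in> B" "p0 \<in> fst c"
      and a: "smooth_curve I X A a" and b: "smooth_curve J X A b"
      and im: "snd c ` fst c = {x. x $ 1 \<in> I \<and> x $ 2 \<in> J}"
      and prod: "\<And>s t. s \<in> I \<Longrightarrow> t \<in> J \<Longrightarrow> \<iota> (inv_into (fst c) (snd c) (vector [s, t])) = a s \<otimes>\<^bsub>G\<^esub> b t"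
      by blast
    define S where "S = {x :: real ^ 2. x $ 1 \<in> I \<and> x $ 2 \<in> J}"
    define \<sigma> where "\<sigma> x = a (x $ 1) \<otimes>\<^bsub>G\<^esub> b (x $ 2)" for x :: "real ^ 2"
    define p where "p = inv_into (fst c) (snd c)"
    \<comment> \<open>Exactly the choice made inside \<open>induced_metric\<close>, so that the
      metric matrix unfolds to the expression required.\<close>
    define d where "d x = (SOME d. d \<in> A \<and> \<sigma> x \<in> fst d)" for x
    note a' = smooth_curve_imp_smooth_param[OF X a] and b' = smooth_curve_imp_smooth_param[OF X b]
    have \<sigma>: "smooth_param X A S \<sigma>"
      unfolding \<sigma>_def[abs_def] S_def by (rule smooth_param_curve_product[OF assms(2) a' b'])
    have p: "p x \<in> fst c" "snd c (p x) = x" if "x \<in> S" for x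
      using that im by (auto simp: p_def S_def intro!: inv_into_into f_inv_into_f)
    have ip: "\<iota> (p x) = \<sigma> x" if "x \<in> S" for x
    proof -
      have "x = vector [x $ 1, x $ 2]" by (simp add: vec_eq_iff forall_2)
      then show ?thesis using prod[of "x $ 1" "x $ 2"] that by (simp add: S_def p_def \<sigma>_def)
    qed
    have d: "d x \<in> A" "\<sigma> x \<in> fst (d x)" if "x \<in> S" for x
    proof -
      have "\<exists>d. d \<in> A \<and> \<sigma> x \<in> fst d"
        using smooth_manifold_cover[OF X smooth_paramD(3)[OF \<sigma> that]] by blast
      then have "d x \<in> A \<and> \<sigma> x \<in> fst (d x)" unfolding d_def by (rule someI_ex)
      then show "d x \<in> A" "\<sigma> x \<in> fst (d x)" by auto
    qed
    have diff: "differential c (d x) \<iota> (p x) = velocity (d x) \<sigma> x" if x: "x \<in> S" for x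
    proof -
      have "(in_charts c (d x) \<iota> has_derivative velocity (d x) \<sigma> x) (at x)"
        by (rule has_derivative_transform_within_open[OF
              velocity_has_derivative[OF assms(2) \<sigma> d(1)[OF x] x d(2)[OF x]] smooth_paramD(1)[OF \<sigma>] x])
          (simp add: in_charts_def flip: p_def ip)
      from frechet_derivative_at[OF this] show ?thesis by (simp add: differential_def p(2)[OF x])
    qed
    have "snd c p0 \<in> S" using c im by (auto simp: S_def)
    then have ne: "snd c p0 $ 1 \<in> I" "snd c p0 $ 2 \<in> J" by (auto simp: S_def)
    show "\<kappa> = 0"
    proof (rule curve_product_constant_curvature_zero[OF assms(2,3) a' b' ne, where h = ?h and c = c and d = d])
      fix x :: "real ^ 2" assume "x \<in> {x. x $ 1 \<in> I \<and> x $ 2 \<in> J}"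
      then have x: "x \<in> S" by (simp add: S_def)
      show "d x \<in> A \<and> a (x $ 1) \<otimes>\<^bsub>G\<^esub> b (x $ 2) \<in> fst (d x)" using d[OF x] by (simp add: \<sigma>_def)
      show "metric_matrix ?h c x $ i $ j = g (d x) (a (x $ 1) \<otimes>\<^bsub>G\<^esub> b (x $ 2))
          (velocity (d x) (\<lambda>x. a (x $ 1) \<otimes>\<^bsub>G\<^esub> b (x $ 2)) x (axis i 1))
          (velocity (d x) (\<lambda>x. a (x $ 1) \<otimes>\<^bsub>G\<^esub> b (x $ 2)) x (axis j 1))" for i j
        using diff[OF x] unfolding \<sigma>_def[abs_def, symmetric] p_def[symmetric]
        by (simp add: metric_matrix_def induced_metric_def Let_def ip[OF x] flip: p_def d_def \<sigma>_def)
      have "inj (differential c (d x) \<iota> (p x))"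
        using imm c(1) d[OF x] p(1)[OF x] unfolding immersion_def ip[OF x, symmetric] by blast
      then show "inj (velocity (d x) (\<lambda>x. a (x $ 1) \<otimes>\<^bsub>G\<^esub> b (x $ 2)) x)"
        by (simp add: diff[OF x] flip: \<sigma>_def)
      show "\<exists>p. snd c p = x \<and> gaussian_curvature ?h c p = \<kappa>"
        using \<kappa> c(1) p[OF x] unfolding constant_gaussian_curvature_def by blast
    qed
  qed
  then show ?thesis using \<kappa> unfolding constant_gaussian_curvature_def by metis
qed

end
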